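(* The following four identities hold in the ring $\mathbb{Z}[z,z^{-1}][[q]]$ of formal power series in $q$ with coefficients that are Laurent polynomials in $z$. (1) $$(zq;q)_\infty (z^{-1}q;q)_\infty (q;q)_\infty \sum_{n=0}^\infty \frac{q^{n^2}}{(zq;q)_n (z^{-1}q;q)_n} = \frac12\sum_{n=0}^\infty\left(\sum_{j=0}^{\lfloor n/2\rfloor}(-1)^{n+j}(z^{n-3j}+z^{3j-n})\,q^{\frac12(n^2-3j^2)+\frac12(n-j)}+\sum_{j=1}^{\lfloor n/2\rfloor}(-1)^{n+j}(z^{n-3j+1}+z^{3j-n-1})\,q^{\frac12(n^2-3j^2)+\frac12(n+j)}\right).$$ (2) $$(1+z)(zq;q)_\infty (z^{-1}q;q)_\infty (q;q)_\infty \sum_{n=0}^\infty \frac{(-1;q)_n\, q^{\frac12 n(n+1)}}{(zq;q)_n (z^{-1}q;q)_n} = \sum_{n=0}^\infty\ \sum_{|m|\le \lfloor n/2\rfloor}(-1)^{n+m}(z^{n-2|m|+1}+z^{2|m|-n})\,q^{\frac12(n^2-2m^2)+\frac12 n}.$$ (3) $$(1+z)(zq;q)_\infty (z^{-1}q;q)_\infty (q;q)_\infty \sum_{n=0}^\infty \frac{(-1;q)_n\, q^{\frac12 n(n+1)}}{(zq;q)_n (z^{-1}q;q)_n} = \sum_{n=0}^\infty\ \sum_{|m|\le \lfloor n/3\rfloor}(-1)^{n}(z^{n+1-4|m|}+z^{4|m|-n})\,q^{\frac12(n^2-8m^2)+\frac12 n}.$$ (4) $$(zq^2;q^2)_\infty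 (z^{-1}q^2;q^2)_\infty (q^2;q^2)_\infty \sum_{n=0}^\infty \frac{(-1)^n q^{n^2}(q;q^2)_n}{(zq^2;q^2)_n (z^{-1}q^2;q^2)_n} = \sum_{n=0}^\infty\left(\sum_{m=0}^{n}(-1)^n z^{m-n}q^{\frac12(2n^2-m^2)+\frac12(2n-m)}+\sum_{m=1}^{n}(-1)^n z^{n-m+1}q^{\frac12(2n^2-m^2)+\frac12(2n+m)}\right).$$
   Context: Notation: $(a;q)_\infty=\prod_{k\ge 0}(1-aq^k)$ and $(a;q)_n=\prod_{k=0}^{n-1}(1-aq^k)$ for integers $n\ge0$; $(a;q^2)_\infty$ and $(a;q^2)_n$ are defined the same way with $q$ replaced by $q^2$. $\lfloor x\rfloor$ is the integer part of $x$. In (2) and (3), $m$ runs over all integers (positive, negative and zero) in the indicated range. All quotients make sense because each denominator is a power series in $q$ with constant term $1$. The three series $R(z,q)=\sum_{n\ge0} \frac{q^{n^2}}{(zq;q)_n(z^{-1}q;q)_n}$, $H(z,q)=\sum_{n\ge0}\frac{(-1;q)_n q^{n(n+1)/2}}{(zq;q)_n(z^{-1}q;q)_n}$ and $K(z,q)=\sum_{n\ge0}\frac{(-1)^n(q;q^2)_nq^{n^2}}{(zq^2;q^2)_n(z^{-1}q^2;q^2)_n}$ are called universal mock theta functions. *)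

theory Defs
  imports "HOL-Analysis.Analysis" "HOL-Library.Poly_Mapping"
begin

text \<open>
  The Laurent polynomial ring over the integers in \<open>z\<close> is the group ring of the additive group
  \<open>int\<close>, i.e. \<^typ>\<open>int \<Rightarrow>\<^sub>0 int\<close> with its convolution product. Infinite sums and
  products of power series are \<^const>\<open>suminf\<close> and \<^const>\<open>prodinf\<close> for the library's
  (\<open>q\<close>-adic) topology on \<^typ>\<open>'a fps\<close>.
\<close>

type_synonym zq_series = "(int \<Rightarrow>\<^sub>0 int) fps"

abbreviation q :: zq_series where "q \<equiv> fps_X"

definition zpow :: "int \<Rightarrow> zq_series" where
  "zpow a = fps_const (Poly_Mapping.single a 1)"

text \<open>\<open>qhalf e\<close> is \<open>q\<close> to the power \<open>e / 2\<close>. It is only meant for even \<open>e \<ge> 0\<close>; the lemmas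
  \<open>expo1\<close> to \<open>expo4\<close> below check this for every exponent to which it is applied.\<close>

definition qhalf :: "int \<Rightarrow> zq_series" where
  "qhalf e = q ^ nat (e div 2)"

definition qpoch :: "'a::comm_ring_1 \<Rightarrow> 'a \<Rightarrow> nat \<Rightarrow> 'a" where
  "qpoch a p n = (\<Prod>k<n. 1 - a * p ^ k)"

definition qpoch_inf :: "'a::{t2_space,comm_ring_1} \<Rightarrow> 'a \<Rightarrow> 'a" where
  "qpoch_inf a p = prodinf (\<lambda>k. 1 - a * p ^ k)"

text \<open>Quotient by a series with constant term 1. The division on \<^typ>\<open>'a fps\<close> is not available,
  since the coefficients are not a field; \<open>fps_right_inverse g 1\<close> is the library's inverse of
  \<open>g\<close> when \<open>fps_nth g 0 = 1\<close>.\<close>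

definition fps_quot :: "zq_series \<Rightarrow> zq_series \<Rightarrow> zq_series" where
  "fps_quot f g = f * fps_right_inverse g 1"

definition R_term :: "nat \<Rightarrow> zq_series" where
  "R_term n = fps_quot (q ^ n\<^sup>2) (qpoch (zpow 1 * q) q n * qpoch (zpow (-1) * q) q n)"

definition H_term :: "nat \<Rightarrow> zq_series" where
  "H_term n = fps_quot (qpoch (-1) q n * q ^ (n * (n + 1) div 2))
     (qpoch (zpow 1 * q) q n * qpoch (zpow (-1) * q) q n)"

definition K_term :: "nat \<Rightarrow> zq_series" where
  "K_term n = fps_quot ((-1) ^ n * q ^ n\<^sup>2 * qpoch q (q\<^sup>2) n)
     (qpoch (zpow 1 * q\<^sup>2) (q\<^sup>2) n * qpoch (zpow (-1) * q\<^sup>2) (q\<^sup>2) n)"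

definition R_series :: zq_series where "R_series = suminf R_term"
definition H_series :: zq_series where "H_series = suminf H_term"
definition K_series :: zq_series where "K_series = suminf K_term"

text \<open>The right-hand sides are \<open>suminf rhs1_term\<close> (this one is to be halved: since the ring is
  torsion-free but does not contain \<open>1/2\<close>, the first identity is stated as twice the left-hand side
  being equal to it), \<open>suminf rhs2_term\<close>, and so on. In the second and third, \<open>m\<close> ranges
  over integers of both signs, and \<open>(-1)\<close> to the power \<open>n + m\<close> is written with
  \<open>nat \<bar>m\<bar>\<close>, which has the parity of \<open>m\<close>.\<close>

definition rhs1_term :: "nat \<Rightarrow> zq_series" where
  "rhs1_term n =
     (\<Sum>j=0..n div 2. (-1) ^ (n + j) *
        (zpow (int n - 3 * int j) + zpow (3 * int j - int n)) *
        qhalf (((int n)\<^sup>2 - 3 * (int j)\<^sup>2) + (int n - int j))) +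
     (\<Sum>j=1..n div 2. (-1) ^ (n + j) *
        (zpow (int n - 3 * int j + 1) + zpow (3 * int j - int n - 1)) *
        qhalf (((int n)\<^sup>2 - 3 * (int j)\<^sup>2) + (int n + int j)))"

definition rhs2_term :: "nat \<Rightarrow> zq_series" where
  "rhs2_term n =
     (\<Sum>m\<in>{- int (n div 2)..int (n div 2)}. (-1) ^ (n + nat \<bar>m\<bar>) *
        (zpow (int n - 2 * \<bar>m\<bar> + 1) + zpow (2 * \<bar>m\<bar> - int n)) *
        qhalf (((int n)\<^sup>2 - 2 * m\<^sup>2) + int n))"

definition rhs3_term :: "nat \<Rightarrow> zq_series" where
  "rhs3_term n =
     (\<Sum>m\<in>{- int (n div 3)..int (n div 3)}. (-1) ^ n *
        (zpow (int n + 1 - 4 * \<bar>m\<bar>) + zpow (4 * \<bar>m\<bar> - int n)) *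
        qhalf (((int n)\<^sup>2 - 8 * m\<^sup>2) + int n))"

definition rhs4_term :: "nat \<Rightarrow> zq_series" where
  "rhs4_term n =
     (\<Sum>m=0..n. (-1) ^ n * zpow (int m - int n) *
        qhalf ((2 * (int n)\<^sup>2 - (int m)\<^sup>2) + (2 * int n - int m))) +
     (\<Sum>m=1..n. (-1) ^ n * zpow (int n - int m + 1) *
        qhalf ((2 * (int n)\<^sup>2 - (int m)\<^sup>2) + (2 * int n + int m)))"

subsection \<open>The exponents, quotients, sums and products are meaningful\<close>

lemma expo1:
  assumes "j \<le> n div 2"
  shows "even (((int n)\<^sup>2 - 3 * (int j)\<^sup>2) + (int n - int j))"
    and "int n \<le> ((int n)\<^sup>2 - 3 * (int j)\<^sup>2) + (int n - int j)"
    and "even (((int n)\<^sup>2 - 3 * (int j)\<^sup>2) + (int n + int j))"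
    and "int n \<le> ((int n)\<^sup>2 - 3 * (int j)\<^sup>2) + (int n + int j)"
proof -
  have "(2 * int j)\<^sup>2 \<le> (int n)\<^sup>2" using assms by (intro power_mono) auto
  then have "4 * (int j)\<^sup>2 \<le> (int n)\<^sup>2" by (simp add: power_mult_distrib)
  moreover have "int j \<le> (int j)\<^sup>2"
    by (simp add: power2_eq_square le_square flip: of_nat_mult)
  ultimately show "int n \<le> ((int n)\<^sup>2 - 3 * (int j)\<^sup>2) + (int n - int j)"
    "int n \<le> ((int n)\<^sup>2 - 3 * (int j)\<^sup>2) + (int n + int j)"
    by linarith+
qed auto

lemma expo2:
  assumes "m \<in> {- int (n div 2)..int (n div 2)}"
  shows "even (((int n)\<^sup>2 - 2 * m\<^sup>2) + int n)" and "int n \<le> ((int n)\<^sup>2 - 2 * m\<^sup>2) + int n"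
proof -
  have "(2 * \<bar>m\<bar>)\<^sup>2 \<le> (int n)\<^sup>2" using assms by (intro power_mono) auto
  then have "4 * m\<^sup>2 \<le> (int n)\<^sup>2" by (simp add: power_mult_distrib)
  then show "int n \<le> ((int n)\<^sup>2 - 2 * m\<^sup>2) + int n" using zero_le_power2[of m] by linarith
qed auto

lemma expo3:
  assumes "m \<in> {- int (n div 3)..int (n div 3)}"
  shows "even (((int n)\<^sup>2 - 8 * m\<^sup>2) + int n)" and "int n \<le> ((int n)\<^sup>2 - 8 * m\<^sup>2) + int n"
proof -
  have "(3 * \<bar>m\<bar>)\<^sup>2 \<le> (int n)\<^sup>2" using assms by (intro power_mono) auto
  then have "9 * m\<^sup>2 \<le> (int n)\<^sup>2" by (simp add: power_mult_distrib)
  then show "int n \<le> ((int n)\<^sup>2 - 8 * m\<^sup>2) + int n" using zero_le_power2[of m] by linarith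
qed auto

lemma expo4:
  assumes "m \<le> n"
  shows "even ((2 * (int n)\<^sup>2 - (int m)\<^sup>2) + (2 * int n - int m))"
    and "int n \<le> (2 * (int n)\<^sup>2 - (int m)\<^sup>2) + (2 * int n - int m)"
    and "even ((2 * (int n)\<^sup>2 - (int m)\<^sup>2) + (2 * int n + int m))"
    and "int n \<le> (2 * (int n)\<^sup>2 - (int m)\<^sup>2) + (2 * int n + int m)"
proof -
  have "(int m)\<^sup>2 \<le> (int n)\<^sup>2" using assms by (intro power_mono) auto
  with assms zero_le_power2[of "int n"]
  show "int n \<le> (2 * (int n)\<^sup>2 - (int m)\<^sup>2) + (2 * int n - int m)"
    "int n \<le> (2 * (int n)\<^sup>2 - (int m)\<^sup>2) + (2 * int n + int m)"
    by linarith+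
qed auto

lemma fps_quot_mult:
  assumes "fps_nth g 0 = 1"
  shows "fps_quot f g * g = f"
  using fps_right_inverse[of g 1] assms by (simp add: fps_quot_def mult.assoc mult.commute[of _ g])

lemma qpoch_nth_0:
  assumes "fps_nth (a :: zq_series) 0 = 0"
  shows "fps_nth (qpoch a p n) 0 = 1"
  using assms by (induction n) (auto simp: qpoch_def)

lemma denominators_nth_0:
  "fps_nth (qpoch (zpow 1 * q) q n * qpoch (zpow (-1) * q) q n) 0 = 1"
  "fps_nth (qpoch (zpow 1 * q\<^sup>2) (q\<^sup>2) n * qpoch (zpow (-1) * q\<^sup>2) (q\<^sup>2) n) 0 = 1"
  by (simp_all add: qpoch_nth_0)

lemma summable_fpsI:
  fixes f :: "nat \<Rightarrow> zq_series"
  assumes "\<And>n k. 2 * k < n \<Longrightarrow> fps_nth (f n) k = 0"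
  shows "summable f"
proof -
  have "(\<lambda>n. \<Sum>i<n. f i) \<longlonglongrightarrow> Abs_fps (\<lambda>k. \<Sum>i<Suc (2 * k). fps_nth (f i) k)"
  proof (rule tendsto_fpsI)
    fix k
    have "fps_nth (\<Sum>i<n. f i) k = (\<Sum>i<Suc (2 * k). fps_nth (f i) k)" if "n \<ge> Suc (2 * k)" for n
      unfolding fps_sum_nth using that assms by (intro sum.mono_neutral_right) auto
    then show "\<forall>\<^sub>F n in sequentially. fps_nth (\<Sum>i<n. f i) k =
        fps_nth (Abs_fps (\<lambda>k. \<Sum>i<Suc (2 * k). fps_nth (f i) k)) k"
      by (auto simp: eventually_at_top_linorder intro!: exI[of _ "Suc (2 * k)"])
  qed
  then show ?thesis by (auto simp: summable_def sums_def)
qed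

lemma qpow_mult_nth: "k < e \<Longrightarrow> fps_nth (f * q ^ e) k = 0" for f :: zq_series
  by (simp add: fps_X_power_mult_right_nth)

lemma qhalf_mult_nth:
  assumes "2 * k < n" "int n \<le> e" "even e"
  shows "fps_nth (f * qhalf e) k = 0"
proof -
  obtain c where "e = 2 * c" using \<open>even e\<close> by (rule evenE)
  with assms have "k < nat (e div 2)" by simp
  then show ?thesis unfolding qhalf_def by (rule qpow_mult_nth)
qed

lemma summable_terms:
  "summable R_term" "summable H_term" "summable K_term"
  "summable rhs1_term" "summable rhs2_term" "summable rhs3_term" "summable rhs4_term"
proof -
  have sq: "k < n\<^sup>2" if "2 * k < n" for k n :: nat
  proof -
    have "n \<le> n\<^sup>2" by (simp add: power2_eq_square)
    with that show ?thesis by linarith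
  qed
  have tri: "k < n * (n + 1) div 2" if "2 * k < n" for k n :: nat
  proof -
    have "n * 2 \<le> n * (n + 1)" using that by (intro mult_le_mono2) auto
    with that show ?thesis by linarith
  qed
  have "R_term n = fps_right_inverse (qpoch (zpow 1 * q) q n * qpoch (zpow (-1) * q) q n) 1 *
      q ^ n\<^sup>2" for n
    by (simp add: R_term_def fps_quot_def mult_ac)
  then show "summable R_term"
    by (intro summable_fpsI) (simp only: qpow_mult_nth sq)
  have "H_term n = (qpoch (-1) q n *
      fps_right_inverse (qpoch (zpow 1 * q) q n * qpoch (zpow (-1) * q) q n) 1) *
      q ^ (n * (n + 1) div 2)" for n
    unfolding H_term_def fps_quot_def by (simp only: mult_ac)
  then show "summable H_term"
    by (intro summable_fpsI) (simp only: qpow_mult_nth tri)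
  have "K_term n = ((-1) ^ n * qpoch q (q\<^sup>2) n *
      fps_right_inverse (qpoch (zpow 1 * q\<^sup>2) (q\<^sup>2) n * qpoch (zpow (-1) * q\<^sup>2) (q\<^sup>2) n) 1) *
      q ^ n\<^sup>2" for n
    unfolding K_term_def fps_quot_def by (simp only: mult_ac)
  then show "summable K_term"
    by (intro summable_fpsI) (simp only: qpow_mult_nth sq)
  show "summable rhs1_term"
  proof (rule summable_fpsI)
    fix n k :: nat
    assume "2 * k < n"
    then show "fps_nth (rhs1_term n) k = 0"
      unfolding rhs1_term_def fps_add_nth fps_sum_nth
      by (simp add: qhalf_mult_nth expo1)
  qed
  show "summable rhs2_term"
    unfolding rhs2_term_def
    by (rule summable_fpsI) (auto simp only: fps_sum_nth intro!: sum.neutral qhalf_mult_nth expo2)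
  show "summable rhs3_term"
    unfolding rhs3_term_def
    by (rule summable_fpsI) (auto simp only: fps_sum_nth intro!: sum.neutral qhalf_mult_nth expo3)
  show "summable rhs4_term"
  proof (rule summable_fpsI)
    fix n k :: nat
    assume "2 * k < n"
    then show "fps_nth (rhs4_term n) k = 0"
      unfolding rhs4_term_def fps_add_nth fps_sum_nth
      by (simp add: qhalf_mult_nth expo4)
  qed
qed

lemma qpoch_inf_has_prod:
  fixes a p :: zq_series
  assumes "fps_nth a 0 = 0" "fps_nth p 0 = 0"
  shows "(\<lambda>k. 1 - a * p ^ k) has_prod qpoch_inf a p"
proof -
  define P where "P = (\<lambda>n. \<Prod>i\<le>n. 1 - a * p ^ i)"
  have pw: "fps_nth (p ^ i) k = 0" if "k < i" for i k
    using assms(2) that startsby_zero_power_prefix by blast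
  have step: "fps_nth (P (Suc n)) k = fps_nth (P n) k" if "k \<le> n" for n k
  proof -
    have "P (Suc n) = P n - (P n * a) * p ^ Suc n" by (simp add: P_def algebra_simps)
    moreover have "fps_nth ((P n * a) * p ^ Suc n) k = 0"
      unfolding fps_mult_nth by (rule sum.neutral) (use that pw[of _ "Suc n"] in auto)
    ultimately show ?thesis by simp
  qed
  have stable: "fps_nth (P n) k = fps_nth (P k) k" if "k \<le> n" for n k
    using that by (induction n rule: dec_induct) (auto simp: step)
  have lim: "P \<longlonglongrightarrow> Abs_fps (\<lambda>k. fps_nth (P k) k)"
    by (rule tendsto_fpsI) (auto simp: eventually_at_top_linorder intro!: stable)
  moreover have "fps_nth (P 0) 0 = 1" using assms(1) by (simp add: P_def)
  then have "Abs_fps (\<lambda>k. fps_nth (P k) k) \<noteq> 0"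
    by (metis fps_nth_Abs_fps fps_zero_nth zero_neq_one)
  ultimately have *: "(\<lambda>k. 1 - a * p ^ k) has_prod Abs_fps (\<lambda>k. fps_nth (P k) k)"
    by (simp add: has_prod_def raw_has_prod_def P_def)
  show ?thesis
    unfolding qpoch_inf_def has_prod_unique[OF *, symmetric] by (rule *)
qed

end

theory Submission
  imports Defs
begin

text \<open>
  Multiplying a summand with denominator \<open>(zp;p)\<^sub>n (z\<^sup>-\<^sup>1p;p)\<^sub>n\<close> by the triple product leaves the tail
  \<open>W\<^sub>n = (zp\<^sup>n\<^sup>+\<^sup>1;p)\<^sub>\<infinity> (z\<^sup>-\<^sup>1p\<^sup>n\<^sup>+\<^sup>1;p)\<^sub>\<infinity> (p;p)\<^sub>\<infinity>\<close>. Its coefficient of \<open>z\<^sup>k\<close> is, up to a sign and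
  a power of \<open>p\<close>, the series \<open>t\<^sub>k(l) = \<Sum>\<^sub>m (-1)\<^sup>m p\<^bsup>m(m+1)/2 + mk\<^esup> [l + m choose m]\<^sub>p\<close> for
  \<open>l = 2n\<close> with \<open>|k|\<close> in place of \<open>k\<close>: by the two Pascal rules these series obey the recurrence
  that comes from \<open>W\<^sub>n = (1 - zp\<^sup>n\<^sup>+\<^sup>1)(1 - z\<^sup>-\<^sup>1p\<^sup>n\<^sup>+\<^sup>1) W\<^sub>n\<^sub>+\<^sub>1\<close>, and both sides tend to \<open>(p;p)\<^sub>\<infinity>\<close>.
  So the coefficient of \<open>z\<^sup>k\<close> on the left is essentially \<open>\<beta>\<^sub>k = \<Sum>\<^sub>n c\<^sub>n p\<^sup>n\<^sup>k t\<^sub>k(2n)\<close>. Each of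
  the three choices of \<open>c\<^sub>n\<close> admits a telescoping relation between \<open>\<beta>\<^sub>k\<close>, \<open>\<beta>\<^sub>k\<^sub>+\<^sub>1\<close>, \<open>\<beta>\<^sub>k\<^sub>+\<^sub>2\<close> whose
  iteration gives a partial theta series, and this is the coefficient of \<open>z\<^sup>k\<close> on the right.
\<close>

section \<open>Convergence of formal power series\<close>

text \<open>Each coefficient of a sum depends only on the same coefficient of the summands, so
  eventual agreement of coefficients is preserved. This makes \<open>sums_add\<close> and
  \<open>tendsto_add\<close> available for power series.\<close>

instance fps :: (ab_group_add) topological_comm_monoid_add
proof
  fix a b :: "'a fps"
  show "((\<lambda>x. fst x + snd x) \<longlongrightarrow> a + b) (nhds a \<times>\<^sub>F nhds b)"
  proof (rule tendsto_fpsI)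
    fix n
    have "\<forall>\<^sub>F x in nhds a. fps_nth x n = fps_nth a n" "\<forall>\<^sub>F x in nhds b. fps_nth x n = fps_nth b n"
      by (simp_all add: tendsto_fps_iff[THEN iffD1, OF filterlim_ident])
    then show "\<forall>\<^sub>F x in nhds a \<times>\<^sub>F nhds b. fps_nth (fst x + snd x) n = fps_nth (a + b) n"
      unfolding eventually_prod_filter
      by (intro exI[of _ "\<lambda>x. fps_nth x n = fps_nth a n"] exI[of _ "\<lambda>x. fps_nth x n = fps_nth b n"])
         simp
  qed
qed

text \<open>Coefficient \<open>n\<close> of a product involves only the coefficients
  \<open>0\<close> to \<open>n\<close> of its factors: finitely many eventual equalities, which can
  be required at once.\<close>

lemma tendsto_fps_mult_left:
  fixes f :: "'b \<Rightarrow> 'a::comm_ring_1 fps"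
  assumes "(f \<longlongrightarrow> s) F"
  shows "((\<lambda>x. c * f x) \<longlongrightarrow> c * s) F"
proof (rule tendsto_fpsI)
  fix n
  have "\<forall>\<^sub>F x in F. \<forall>i\<in>{..n}. fps_nth (f x) i = fps_nth s i"
    using assms by (subst eventually_ball_finite_distrib) (auto simp: tendsto_fps_iff)
  then show "\<forall>\<^sub>F x in F. fps_nth (c * f x) n = fps_nth (c * s) n"
    by eventually_elim (auto simp: fps_mult_nth intro!: sum.cong)
qed

lemma fps_sums_mult:
  fixes f :: "nat \<Rightarrow> 'a::comm_ring_1 fps"
  assumes "f sums s"
  shows "(\<lambda>n. c * f n) sums (c * s)"
  using tendsto_fps_mult_left[of _ _ _ c] assms by (simp add: sums_def flip: sum_distrib_left)

lemma fps_sums_diff_mult: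
  fixes f :: "nat \<Rightarrow> 'a::comm_ring_1 fps"
  assumes "f sums s" "g sums t"
  shows "(\<lambda>n. f n - c * g n) sums (s - c * t)"
  using sums_add[OF assms(1) fps_sums_mult[OF assms(2), of "- c"]] by simp

lemma fps_X_power_dvd_iff:
  "fps_X ^ m dvd (f :: 'a::comm_ring_1 fps) \<longleftrightarrow> (\<forall>k<m. fps_nth f k = 0)"
proof
  show "\<forall>k<m. fps_nth f k = 0" if "fps_X ^ m dvd f"
    using that by (auto simp: fps_X_power_mult_nth elim!: dvdE)
next
  assume "\<forall>k<m. fps_nth f k = 0"
  then have "f = fps_X ^ m * fps_shift m f"
    by (intro fps_ext) (simp add: fps_X_power_mult_nth)
  then show "fps_X ^ m dvd f" by (metis dvd_triv_left)
qed

lemma dvd_power_of_dvd: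
  fixes x p :: "'a::comm_semiring_1"
  assumes "x dvd p" "m \<le> e"
  shows "x ^ m dvd p ^ e"
  using dvd_power_same[OF assms(1), of m] le_imp_power_dvd[OF assms(2), of p] dvd_trans by blast

lemma fps_dvd_tendsto_0:
  fixes f :: "nat \<Rightarrow> 'a::comm_ring_1 fps"
  assumes "\<And>n. fps_X ^ n dvd f n"
  shows "f \<longlonglongrightarrow> 0"
proof (rule tendsto_fpsI)
  fix k
  show "\<forall>\<^sub>F n in sequentially. fps_nth (f n) k = fps_nth 0 k"
    using assms by (auto simp: fps_X_power_dvd_iff intro!: eventually_sequentiallyI[of "Suc k"])
qed

lemma fps_dvd_summable:
  fixes f :: "nat \<Rightarrow> 'a::comm_ring_1 fps"
  assumes "\<And>n. fps_X ^ n dvd f n"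
  shows "summable f"
proof -
  have "(\<lambda>n. \<Sum>i<n. f i) \<longlonglongrightarrow> Abs_fps (\<lambda>k. \<Sum>i<Suc k. fps_nth (f i) k)"
  proof (rule tendsto_fpsI)
    fix k
    have "fps_nth (\<Sum>i<n. f i) k = (\<Sum>i<Suc k. fps_nth (f i) k)" if "n \<ge> Suc k" for n
      unfolding fps_sum_nth using that assms
      by (intro sum.mono_neutral_right) (auto simp: fps_X_power_dvd_iff)
    then show "\<forall>\<^sub>F n in sequentially. fps_nth (\<Sum>i<n. f i) k =
        fps_nth (Abs_fps (\<lambda>k. \<Sum>i<Suc k. fps_nth (f i) k)) k"
      by (auto intro!: eventually_sequentiallyI[of "Suc k"])
  qed
  then show ?thesis by (auto simp: summable_def sums_def)
qed

lemma fps_dvd_limit: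
  fixes f :: "nat \<Rightarrow> 'a::comm_ring_1 fps"
  assumes "f \<longlonglongrightarrow> s" "\<And>n. n \<ge> N \<Longrightarrow> fps_X ^ m dvd f n"
  shows "fps_X ^ m dvd s"
  unfolding fps_X_power_dvd_iff
proof (intro allI impI)
  fix k assume "k < m"
  have "\<forall>\<^sub>F n in sequentially. fps_nth (f n) k = fps_nth s k"
    using assms(1) by (simp add: tendsto_fps_iff)
  moreover have "\<forall>\<^sub>F n in sequentially. fps_nth (f n) k = 0"
    using assms(2) \<open>k < m\<close> by (auto simp: fps_X_power_dvd_iff intro!: eventually_sequentiallyI[of N])
  ultimately have "\<forall>\<^sub>F n in sequentially. fps_nth s k = 0"
    by eventually_elim simp
  then show "fps_nth s k = 0" by simp
qed

lemma fps_dvd_sums: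
  fixes f :: "nat \<Rightarrow> 'a::comm_ring_1 fps"
  assumes "f sums s" "\<And>n. fps_X ^ m dvd f n"
  shows "fps_X ^ m dvd s"
  using assms by (intro fps_dvd_limit[of "\<lambda>n. \<Sum>i<n. f i" s 0]) (auto simp: sums_def intro!: dvd_sum)

lemma fps_telescope_sums:
  fixes f :: "nat \<Rightarrow> 'a::comm_ring_1 fps"
  assumes "\<And>n. fps_X ^ n dvd f n"
  shows "(\<lambda>n. f n - f (Suc n)) sums f 0"
proof -
  have "(\<lambda>n. f 0 + (-1) * f n) \<longlonglongrightarrow> f 0 + (-1) * 0"
    by (intro tendsto_add tendsto_const tendsto_fps_mult_left fps_dvd_tendsto_0 assms)
  moreover have "(\<Sum>i<n. f i - f (Suc i)) = f 0 + (-1) * f n" for n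
    by (induction n) (simp_all add: algebra_simps)
  ultimately show ?thesis by (simp add: sums_def)
qed

text \<open>Fits Pascal-type recurrences, where one part of a term keeps its index and the other
  drops it by one. A zero put in front of \<open>h\<close> turns the hypothesis into a termwise
  identity.\<close>

lemma suminf_eq_diff_shifted:
  fixes f g h :: "nat \<Rightarrow> 'a::comm_ring_1 fps"
  assumes "summable f" "summable g" "summable h"
    and "f 0 = g 0" "\<And>m. f (Suc m) = g (Suc m) - c * h m"
  shows "suminf f = suminf g - c * suminf h"
proof -
  define h' where "h' = (\<lambda>m. case m of 0 \<Rightarrow> 0 | Suc m \<Rightarrow> h m)"
  have "h' sums suminf h"
    using sums_Suc[of h' "suminf h"] summable_sums[OF assms(3)] by (simp add: h'_def)
  from fps_sums_diff_mult[OF summable_sums[OF assms(2)] this, of c]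
  have "(\<lambda>m. g m - c * h' m) sums (suminf g - c * suminf h)" .
  moreover have "f = (\<lambda>m. g m - c * h' m)"
  proof
    show "f m = g m - c * h' m" for m
      using assms(4,5) by (cases m) (simp_all add: h'_def)
  qed
  ultimately show ?thesis by (simp add: sums_iff)
qed

lemma fps_sums_even_odd:
  fixes h :: "nat \<Rightarrow> 'a::comm_ring_1 fps"
  assumes "(\<lambda>i. h (2 * i)) sums a" "(\<lambda>i. h (2 * i + 1)) sums b"
  shows "h sums (a + b)"
proof -
  have "(\<lambda>n. if even n then h n else 0) sums a"
    using assms(1) by (subst sums_mono_reindex[of "\<lambda>i. 2 * i", symmetric]) (auto simp: strict_mono_def elim!: evenE)
  moreover have "(\<lambda>n. if odd n then h n else 0) sums b"
    using assms(2) by (subst sums_mono_reindex[of "\<lambda>i. 2 * i + 1", symmetric]) (auto simp: strict_mono_def elim!: oddE)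
  ultimately have "(\<lambda>n. (if even n then h n else 0) + (if odd n then h n else 0)) sums (a + b)"
    by (rule sums_add)
  moreover have "(\<lambda>n. (if even n then h n else 0) + (if odd n then h n else 0)) = h"
    by auto
  ultimately show ?thesis by simp
qed

lemma qpoch_Suc: "qpoch a p (Suc n) = qpoch a p n * (1 - a * p ^ n)"
  by (simp add: qpoch_def)

section \<open>Gaussian binomial coefficients and their partial theta series\<close>

text \<open>\<open>gbin p n m\<close> is the Gaussian binomial coefficient of \<open>n + m\<close> over \<open>m\<close> in base \<open>p\<close>.\<close>

fun gbin :: "'a::comm_ring_1 \<Rightarrow> nat \<Rightarrow> nat \<Rightarrow> 'a" where
  "gbin p 0 m = 1"
| "gbin p (Suc n) 0 = 1"
| "gbin p (Suc n) (Suc m) = gbin p (Suc n) m + p ^ Suc m * gbin p n (Suc m)"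

lemma gbin_0_right [simp]: "gbin p n 0 = 1"
  by (cases n) auto

text \<open>The other Pascal rule. Both summands of the defining recurrence are rewritten by the
  induction hypotheses; after regrouping, the defining recurrence folds them up again.\<close>

lemma gbin_Suc_Suc':
  "gbin p (Suc n) (Suc m) = p ^ Suc n * gbin p (Suc n) m + gbin p n (Suc m)"
proof (induction p n m rule: gbin.induct)
  case (1 p m)
  have "gbin p (Suc 0) m + p * p ^ m = 1 + p * gbin p (Suc 0) m"
  proof (induction m)
    case (Suc m)
    have "gbin p (Suc 0) (Suc m) + p * p ^ Suc m = gbin p (Suc 0) m + p * p ^ m + p * (p * p ^ m)"
      by simp
    also have "\<dots> = 1 + p * gbin p (Suc 0) (Suc m)"
      unfolding Suc by (simp add: algebra_simps)
    finally show ?case .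
  qed simp
  then show ?case by (simp add: algebra_simps)
next
  case (2 p n)
  show ?case by (induction n) (simp_all add: algebra_simps)
next
  case (3 p n m)
  have "gbin p (Suc (Suc n)) (Suc (Suc m)) =
      (p ^ Suc (Suc n) * gbin p (Suc (Suc n)) m + gbin p (Suc n) (Suc m)) +
      p ^ Suc (Suc m) * (p ^ Suc n * gbin p (Suc n) (Suc m) + gbin p n (Suc (Suc m)))"
    unfolding "3.IH"[symmetric] by (rule gbin.simps)
  also have "\<dots> = p ^ Suc (Suc n) * (gbin p (Suc (Suc n)) m + p ^ Suc m * gbin p (Suc n) (Suc m)) +
      (gbin p (Suc n) (Suc m) + p ^ Suc (Suc m) * gbin p n (Suc (Suc m)))"
    by (simp add: distrib_left mult_ac del: gbin.simps)
  finally show ?case unfolding gbin.simps(3)[symmetric] .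
qed

text \<open>Interpolates between a partial theta series at \<open>l = 0\<close> and, for
  \<open>p\<close> without constant term, Euler's series for (p^(k+1);p)_\<infinity> as
  \<open>l\<close> grows.\<close>

definition ptheta_term :: "int fps \<Rightarrow> nat \<Rightarrow> nat \<Rightarrow> nat \<Rightarrow> int fps" where
  "ptheta_term p k l m = (-1) ^ m * p ^ (m * (m + 1) div 2 + m * k) * gbin p l m"

definition ptheta :: "int fps \<Rightarrow> nat \<Rightarrow> nat \<Rightarrow> int fps" where
  "ptheta p k l = suminf (ptheta_term p k l)"

lemma tri_Suc: "Suc m * (Suc m + 1) div 2 = m * (m + 1) div 2 + Suc m"
proof -
  have "Suc m * (Suc m + 1) = m * (m + 1) + 2 * Suc m" by simp
  then show ?thesis by (simp only: div_mult_self2)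
qed

lemma le_tri: "m \<le> m * (m + 1) div 2" for m :: nat
proof (induction m)
  case (Suc m)
  show ?case unfolding tri_Suc by simp
qed simp

context
  fixes p :: "int fps"
  assumes p: "fps_X dvd p"
begin

lemma summable_ptheta: "summable (ptheta_term p k l)"
  unfolding ptheta_term_def
  by (intro fps_dvd_summable dvd_mult2 dvd_mult dvd_power_of_dvd p) (rule trans_le_add1[OF le_tri])

text \<open>The defining Pascal rule, termwise: the factor \<open>p ^ Suc m\<close> raises
  \<open>k\<close> by one, and the summand without it is the shifted part.\<close>

lemma ptheta_Suc:
  "ptheta p k (Suc l) = ptheta p (Suc k) l - p ^ Suc k * ptheta p (Suc k) (Suc l)"
  unfolding ptheta_def
proof (rule suminf_eq_diff_shifted[OF summable_ptheta summable_ptheta summable_ptheta])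
  fix m
  show "ptheta_term p k (Suc l) (Suc m) = ptheta_term p (Suc k) l (Suc m) -
      p ^ Suc k * ptheta_term p (Suc k) (Suc l) m"
    unfolding ptheta_term_def tri_Suc gbin.simps by (simp add: algebra_simps power_add)
qed (simp add: ptheta_term_def)

text \<open>The other Pascal rule, termwise: the unshifted part keeps \<open>k\<close>, and the
  factor \<open>p ^ Suc l\<close> joins the \<open>p ^ Suc k\<close> produced by the shift.\<close>

lemma ptheta_Suc':
  "ptheta p k (Suc l) = ptheta p k l - p ^ (k + l + 2) * ptheta p (Suc k) (Suc l)"
  unfolding ptheta_def
proof (rule suminf_eq_diff_shifted[OF summable_ptheta summable_ptheta summable_ptheta])
  fix m
  show "ptheta_term p k (Suc l) (Suc m) = ptheta_term p k l (Suc m) -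
      p ^ (k + l + 2) * ptheta_term p (Suc k) (Suc l) m"
    unfolding ptheta_term_def tri_Suc gbin_Suc_Suc' by (simp add: algebra_simps power_add)
qed (simp add: ptheta_term_def)

text \<open>All Gaussian binomials are 1 here, so splitting off the term \<open>m = 0\<close> gives
  the functional equation of a partial theta series. It supplies the boundary value of every
  telescoping sum below.\<close>

lemma ptheta_0: "ptheta p k 0 = 1 - p ^ Suc k * ptheta p (Suc k) 0"
proof -
  have "suminf (ptheta_term p k 0) =
      suminf (\<lambda>m. if m = 0 then 1 else 0) - p ^ Suc k * suminf (ptheta_term p (Suc k) 0)"
    by (rule suminf_eq_diff_shifted[OF summable_ptheta _ summable_ptheta])
       (simp, simp add: ptheta_term_def,
        unfold ptheta_term_def tri_Suc, simp add: algebra_simps power_add)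
  also have "suminf (\<lambda>m::nat. if m = 0 then 1 else 0 :: int fps) = 1"
    using suminf_finite[of "{0}" "\<lambda>m::nat. if m = 0 then 1 else 0 :: int fps"] by simp
  finally show ?thesis by (simp add: ptheta_def)
qed

lemma ptheta_cong_1: "fps_X ^ k dvd ptheta p k l - 1"
proof -
  have "(\<lambda>m. ptheta_term p k l m - 1 * (if m = 0 then 1 else 0)) sums (ptheta p k l - 1 * 1)"
    unfolding ptheta_def
    by (intro fps_sums_diff_mult summable_sums summable_ptheta) (rule sums_single)
  moreover have "fps_X ^ k dvd ptheta_term p k l m - 1 * (if m = 0 then 1 else 0)" for m
  proof (cases m)
    case (Suc m')
    then have "k \<le> m * (m + 1) div 2 + m * k" by simp
    from dvd_power_of_dvd[OF p this] Suc show ?thesis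
      by (simp add: ptheta_term_def)
  qed (simp add: ptheta_term_def)
  ultimately have "fps_X ^ k dvd ptheta p k l - 1 * 1" by (rule fps_dvd_sums)
  then show ?thesis by simp
qed

text \<open>Eliminating \<open>ptheta p (Suc k) l\<close> between the two rules shows that raising
  \<open>k\<close> by one splits off the factor \<open>1 - p ^ Suc k\<close>, up to an error
  divisible by \<open>fps_X ^ l\<close>. After \<open>l\<close> such steps the remaining series is 1
  modulo \<open>fps_X ^ l\<close>.\<close>

lemma ptheta_cong_qpoch: "fps_X ^ l dvd ptheta p 0 (Suc l) - qpoch p p l"
proof -
  have "fps_X ^ l dvd ptheta p 0 (Suc l) - qpoch p p k * ptheta p k (Suc l)" for k
  proof (induction k)
    case 0
    show ?case by (simp add: qpoch_def)
  next
    case (Suc k)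
    have "ptheta p k (Suc l) =
        (1 - p ^ Suc k) * ptheta p (Suc k) (Suc l) + p ^ (Suc k + l + 2) * ptheta p (Suc (Suc k)) (Suc l)"
      using ptheta_Suc[of k l] ptheta_Suc'[of "Suc k" l] unfolding left_diff_distrib by simp
    then have "ptheta p 0 (Suc l) - qpoch p p (Suc k) * ptheta p (Suc k) (Suc l) =
        (ptheta p 0 (Suc l) - qpoch p p k * ptheta p k (Suc l)) +
        qpoch p p k * (p ^ (Suc k + l + 2) * ptheta p (Suc (Suc k)) (Suc l))"
      by (simp add: qpoch_Suc) (simp add: algebra_simps)
    moreover have "fps_X ^ l dvd qpoch p p k * (p ^ (Suc k + l + 2) * ptheta p (Suc (Suc k)) (Suc l))"
      by (intro dvd_mult dvd_mult2 dvd_power_of_dvd p) simp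
    ultimately show ?case using dvd_add[OF Suc] by metis
  qed
  then have "fps_X ^ l dvd (ptheta p 0 (Suc l) - qpoch p p l * ptheta p l (Suc l)) +
      qpoch p p l * (ptheta p l (Suc l) - 1)"
    by (intro dvd_add dvd_mult ptheta_cong_1)
  then show ?thesis by (simp add: right_diff_distrib)
qed

end

section \<open>Weighted sums of partial theta series and their telescoping relations\<close>

definition pbeta_term :: "int fps \<Rightarrow> (nat \<Rightarrow> int fps) \<Rightarrow> nat \<Rightarrow> nat \<Rightarrow> int fps" where
  "pbeta_term p c k n = c n * p ^ (n * k) * ptheta p k (2 * n)"

definition pbeta :: "int fps \<Rightarrow> (nat \<Rightarrow> int fps) \<Rightarrow> nat \<Rightarrow> int fps" where
  "pbeta p c k = suminf (pbeta_term p c k)"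

context
  fixes p :: "int fps"
  assumes p: "fps_X dvd p"
begin

text \<open>Two rounds of the rules for \<open>ptheta\<close> carry the pair for \<open>k\<close>
  and \<open>k + 1\<close> from \<open>2 * n + 2\<close> to \<open>2 * n\<close>. The coefficients
  are written in \<open>p ^ k\<close>, \<open>p ^ n\<close> and \<open>p\<close>, so that the
  telescoping becomes polynomial algebra.\<close>

lemma ptheta_step2:
  "ptheta p k (2 * n) = (1 + p ^ k * (p ^ n)\<^sup>2 * p\<^sup>2) * ptheta p k (2 * Suc n) +
     (p ^ k * (p ^ n)\<^sup>2 * p ^ 3 + (p ^ k)\<^sup>2 * (p ^ n)\<^sup>2 * p ^ 3) * ptheta p (Suc k) (2 * Suc n)"
  "ptheta p (Suc k) (2 * n) = (1 + p ^ k * p) * ptheta p k (2 * Suc n) +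
     (p ^ k * (p ^ n)\<^sup>2 * p ^ 3 + (p ^ k)\<^sup>2 * p\<^sup>2) * ptheta p (Suc k) (2 * Suc n)"
proof -
  define a b where "a = ptheta p k (2 * Suc n)" and "b = ptheta p (Suc k) (2 * Suc n)"
  have u: "p ^ (2 * n) = (p ^ n)\<^sup>2" by (simp add: power_mult mult.commute[of 2])
  have 1: "ptheta p k (Suc (2 * n)) = a + p ^ k * (p ^ n)\<^sup>2 * p ^ 3 * b"
    using ptheta_Suc'[OF p, of k "Suc (2 * n)"]
    by (simp add: a_def b_def power_add u eval_nat_numeral algebra_simps)
  have 2: "ptheta p (Suc k) (Suc (2 * n)) = a + p ^ k * p * b"
    using ptheta_Suc[OF p, of k "Suc (2 * n)"] by (simp add: a_def b_def algebra_simps)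
  have "ptheta p k (2 * n) = ptheta p k (Suc (2 * n)) +
      p ^ k * (p ^ n)\<^sup>2 * p\<^sup>2 * ptheta p (Suc k) (Suc (2 * n))"
    using ptheta_Suc'[OF p, of k "2 * n"]
    by (simp add: power_add u eval_nat_numeral algebra_simps)
  also have "\<dots> = (1 + p ^ k * (p ^ n)\<^sup>2 * p\<^sup>2) * a +
     (p ^ k * (p ^ n)\<^sup>2 * p ^ 3 + (p ^ k)\<^sup>2 * (p ^ n)\<^sup>2 * p ^ 3) * b"
    unfolding 1 2 by algebra
  finally show "ptheta p k (2 * n) = (1 + p ^ k * (p ^ n)\<^sup>2 * p\<^sup>2) * ptheta p k (2 * Suc n) +
     (p ^ k * (p ^ n)\<^sup>2 * p ^ 3 + (p ^ k)\<^sup>2 * (p ^ n)\<^sup>2 * p ^ 3) * ptheta p (Suc k) (2 * Suc n)"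
    unfolding a_def b_def .
  have "ptheta p (Suc k) (2 * n) = ptheta p k (Suc (2 * n)) +
      p ^ k * p * ptheta p (Suc k) (Suc (2 * n))"
    using ptheta_Suc[OF p, of k "2 * n"] by (simp add: algebra_simps)
  also have "\<dots> = (1 + p ^ k * p) * a + (p ^ k * (p ^ n)\<^sup>2 * p ^ 3 + (p ^ k)\<^sup>2 * p\<^sup>2) * b"
    unfolding 1 2 by algebra
  finally show "ptheta p (Suc k) (2 * n) = (1 + p ^ k * p) * ptheta p k (2 * Suc n) +
     (p ^ k * (p ^ n)\<^sup>2 * p ^ 3 + (p ^ k)\<^sup>2 * p\<^sup>2) * ptheta p (Suc k) (2 * Suc n)"
    unfolding a_def b_def .
qed

text \<open>A relation in \<open>k\<close> alone: for \<open>n > 0\<close> the two rules are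
  combined by eliminating the value at \<open>2 * n - 1\<close>; at \<open>n = 0\<close>, where
  there is no such value, \<open>ptheta_0\<close> is used twice.\<close>

lemma ptheta_three_term:
  "p ^ k * p\<^sup>2 * (p ^ n)\<^sup>2 * ptheta p (k + 2) (2 * n) =
     ptheta p k (2 * n) + (p ^ k * p - 1) * ptheta p (Suc k) (2 * n)"
proof (cases n)
  case 0
  have "p ^ k * p\<^sup>2 * ptheta p (k + 2) 0 = 1 - ptheta p (Suc k) 0"
    using ptheta_0[OF p, of "Suc k"] by (simp add: power2_eq_square algebra_simps)
  moreover have "1 = ptheta p k 0 + p ^ k * p * ptheta p (Suc k) 0"
    using ptheta_0[OF p, of k] by (simp add: algebra_simps)
  ultimately show ?thesis by (simp add: 0 algebra_simps)
next
  case (Suc m)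
  define l where "l = Suc (2 * m)"
  have l: "2 * n = Suc l" by (simp add: l_def Suc)
  have "p ^ k * p\<^sup>2 * (p ^ n)\<^sup>2 = p ^ (Suc k + l + 2)"
    unfolding power_mult[symmetric] power_add[symmetric] by (simp add: l_def Suc mult.commute)
  moreover have "ptheta p k (Suc l) + p ^ k * p * ptheta p (Suc k) (Suc l) =
      ptheta p (Suc k) (Suc l) + p ^ (Suc k + l + 2) * ptheta p (k + 2) (Suc l)"
    using ptheta_Suc[OF p, of k l] ptheta_Suc'[OF p, of "Suc k" l] by (simp add: mult.commute)
  ultimately show ?thesis unfolding l by (simp add: algebra_simps)
qed

lemma pbeta_sums:
  assumes "\<And>n. fps_X ^ n dvd c n"
  shows "pbeta_term p c k sums pbeta p c k"
  unfolding pbeta_def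
  by (intro summable_sums fps_dvd_summable) (auto simp: pbeta_term_def intro!: dvd_mult2 assms)

end

text \<open>
  In the telescoping certificates, \<open>x = p\<^sup>k\<close>, \<open>u = p\<^sup>n\<close>, \<open>y = p\<^sup>n\<^sup>k\<close> and \<open>c\<close>, \<open>c'\<close> are the weights
  at \<open>n\<close> and \<open>n + 1\<close>; \<open>t0\<close>, \<open>t1\<close>, \<open>t2\<close> are the values of \<open>ptheta\<close> at \<open>2 * n\<close> for \<open>k\<close>, \<open>k + 1\<close>,
  \<open>k + 2\<close>, and \<open>a\<close>, \<open>b\<close> those at \<open>2 * n + 2\<close> for \<open>k\<close>, \<open>k + 1\<close>.
\<close>

lemma certificate_square:
  fixes P x u y c a b t0 t1 t2 :: "'a::comm_ring_1"
  assumes t1: "t1 = (1 + x * P) * a + (x * u\<^sup>2 * P ^ 3 + x\<^sup>2 * P\<^sup>2) * b"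
    and t2: "x * P\<^sup>2 * u\<^sup>2 * t2 = t0 + (x * P - 1) * t1"
    and c': "c' = u\<^sup>2 * P * c"
  shows "c * y * t0 - x ^ 3 * P ^ 4 * (c * (y * u\<^sup>2) * t2) =
    (1 - x * P) * (c * y * ((1 + x * P) * t0 + (x\<^sup>2 * P\<^sup>2 + x * P * u\<^sup>2) * t1)) -
    (1 - x * P) * (c' * (y * x) * ((1 + x * P) * a + (x\<^sup>2 * P\<^sup>2 + x * P * (u * P)\<^sup>2) * b))"
proof -
  \<comment> \<open>The bracket at \<open>n + 1\<close> collapses to \<open>t1\<close>, a value at
    \<open>n\<close>; this is what makes the difference telescope.\<close>
  have Z: "(1 + x * P) * a + (x\<^sup>2 * P\<^sup>2 + x * P * (u * P)\<^sup>2) * b = t1"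
    unfolding t1 by (simp add: eval_nat_numeral algebra_simps)
  have T: "x ^ 3 * P ^ 4 * (c * (y * u\<^sup>2) * t2) = x\<^sup>2 * P\<^sup>2 * c * y * (t0 + (x * P - 1) * t1)"
    unfolding t2[symmetric] by (simp add: eval_nat_numeral mult_ac)
  show ?thesis
    unfolding T Z c' by (simp add: eval_nat_numeral algebra_simps)
qed

text \<open>The certificate of \<open>certificate_square\<close> serves again: the weight ratio has
  the additional summand \<open>u * P\<close>, and its contribution is exactly the middle term with
  \<open>t1\<close>.\<close>

lemma certificate_triangle:
  fixes P x u y c a b t0 t1 t2 :: "'a::comm_ring_1"
  assumes t1: "t1 = (1 + x * P) * a + (x * u\<^sup>2 * P ^ 3 + x\<^sup>2 * P\<^sup>2) * b"
    and t2: "x * P\<^sup>2 * u\<^sup>2 * t2 = t0 + (x * P - 1) * t1"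
    and c': "c' = (1 + u) * u * P * c"
  shows "c * y * t0 - (x * P - x\<^sup>2 * P\<^sup>2) * (c * (y * u) * t1) - x ^ 3 * P ^ 4 * (c * (y * u\<^sup>2) * t2) =
    (1 - x * P) * (c * y * ((1 + x * P) * t0 + (x\<^sup>2 * P\<^sup>2 + x * P * u\<^sup>2) * t1)) -
    (1 - x * P) * (c' * (y * x) * ((1 + x * P) * a + (x\<^sup>2 * P\<^sup>2 + x * P * (u * P)\<^sup>2) * b))"
proof -
  have Z: "(1 + x * P) * a + (x\<^sup>2 * P\<^sup>2 + x * P * (u * P)\<^sup>2) * b = t1"
    unfolding t1 by (simp add: eval_nat_numeral algebra_simps)
  have T: "x ^ 3 * P ^ 4 * (c * (y * u\<^sup>2) * t2) = x\<^sup>2 * P\<^sup>2 * c * y * (t0 + (x * P - 1) * t1)"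
    unfolding t2[symmetric] by (simp add: eval_nat_numeral mult_ac)
  show ?thesis
    unfolding T Z c' by (simp add: eval_nat_numeral algebra_simps)
qed

text \<open>The base is \<open>r\<^sup>2\<close> because the weights involve a square root of it.
  The relation has order one in \<open>k\<close>, so \<open>t0\<close> and \<open>t1\<close> can be
  replaced by \<open>a\<close> and \<open>b\<close> outright, with no three-term relation.\<close>

lemma certificate_sqrt:
  fixes r x u y c a b t0 t1 :: "'a::comm_ring_1"
  assumes "t0 = (1 + x * u\<^sup>2 * (r\<^sup>2)\<^sup>2) * a + (x * u\<^sup>2 * (r\<^sup>2) ^ 3 + x\<^sup>2 * u\<^sup>2 * (r\<^sup>2) ^ 3) * b"
    and "t1 = (1 + x * r\<^sup>2) * a + (x * u\<^sup>2 * (r\<^sup>2) ^ 3 + x\<^sup>2 * (r\<^sup>2)\<^sup>2) * b"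
    and "c' = - ((1 - r * u) * r * u * c)"
  shows "c * y * t0 - r ^ 3 * x\<^sup>2 * (c * (y * u) * t1) =
    (c * y * ((1 - r * x * u) * t0 + (r\<^sup>2 * x * u\<^sup>2 - r ^ 3 * x\<^sup>2 * u) * t1)) -
    (c' * (y * x) * ((1 - r * x * (u * r\<^sup>2)) * a + (r\<^sup>2 * x * (u * r\<^sup>2)\<^sup>2 - r ^ 3 * x\<^sup>2 * (u * r\<^sup>2)) * b))"
  unfolding assms by (simp add: eval_nat_numeral algebra_simps)

lemma pbeta_square:
  fixes p :: "int fps"
  assumes p: "fps_X dvd p"
    and c: "\<And>n. fps_X ^ n dvd c n" "c 0 = 1" "\<And>n. c (Suc n) = (p ^ n)\<^sup>2 * p * c n"
  shows "pbeta p c k - p ^ (3 * k + 4) * pbeta p c (k + 2) = 1 - p ^ (2 * k + 2)"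
proof -
  define Y where "Y = (\<lambda>n. (1 - p ^ k * p) * (c n * p ^ (n * k) * ((1 + p ^ k * p) * ptheta p k (2 * n) +
      ((p ^ k)\<^sup>2 * p\<^sup>2 + p ^ k * p * (p ^ n)\<^sup>2) * ptheta p (Suc k) (2 * n))))"
  have "pbeta_term p c k n - p ^ (3 * k + 4) * pbeta_term p c (k + 2) n = Y n - Y (Suc n)" for n
  proof -
    have 1: "p ^ (3 * k + 4) = (p ^ k) ^ 3 * p ^ 4"
      by (simp only: power_add power_mult[symmetric] mult.commute)
    have 2: "p ^ (n * (k + 2)) = p ^ (n * k) * (p ^ n)\<^sup>2"
      by (simp only: power_add power_mult[symmetric] distrib_left)
    have 3: "p ^ (Suc n * k) = p ^ (n * k) * p ^ k" "p ^ Suc n = p ^ n * p"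
      by (simp_all add: power_add)
    show ?thesis
      unfolding Y_def pbeta_term_def 1 2 3
      by (rule certificate_square[OF ptheta_step2(2)[OF p] ptheta_three_term[OF p] c(3)])
  qed
  moreover have "fps_X ^ n dvd Y n" for n
    unfolding Y_def by (intro dvd_mult dvd_mult2 c)
  ultimately have "(\<lambda>n. pbeta_term p c k n - p ^ (3 * k + 4) * pbeta_term p c (k + 2) n) sums Y 0"
    using fps_telescope_sums[of Y] by simp
  \<comment> \<open>With x = p^(k+1) the bracket has coefficients 1 + x and x^2 + x = x (1 + x), so
    1 + x splits off and joins 1 - x. The last factor is 1 by \<open>ptheta_0\<close>.\<close>
  moreover have "Y 0 = (1 - p ^ (2 * k + 2)) * (ptheta p k 0 + p ^ Suc k * ptheta p (Suc k) 0)"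
    unfolding Y_def by (simp add: c power_add power_mult[of p 2, unfolded mult.commute[of 2]] power2_eq_square algebra_simps)
  moreover have "(\<lambda>n. pbeta_term p c k n - p ^ (3 * k + 4) * pbeta_term p c (k + 2) n) sums
      (pbeta p c k - p ^ (3 * k + 4) * pbeta p c (k + 2))"
    by (intro fps_sums_diff_mult pbeta_sums p c)
  ultimately show ?thesis using ptheta_0[OF p, of k] sums_unique2 by fastforce
qed

lemma pbeta_triangle:
  fixes p :: "int fps"
  assumes p: "fps_X dvd p"
    and c: "\<And>n. fps_X ^ n dvd c n" "c 0 = 1" "\<And>n. c (Suc n) = (1 + p ^ n) * p ^ n * p * c n"
  shows "pbeta p c k - (p ^ Suc k - p ^ (2 * k + 2)) * pbeta p c (Suc k) -
    p ^ (3 * k + 4) * pbeta p c (k + 2) = 1 - p ^ (2 * k + 2)"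
proof -
  define Y where "Y = (\<lambda>n. (1 - p ^ k * p) * (c n * p ^ (n * k) * ((1 + p ^ k * p) * ptheta p k (2 * n) +
      ((p ^ k)\<^sup>2 * p\<^sup>2 + p ^ k * p * (p ^ n)\<^sup>2) * ptheta p (Suc k) (2 * n))))"
  have "pbeta_term p c k n - (p ^ Suc k - p ^ (2 * k + 2)) * pbeta_term p c (Suc k) n -
      p ^ (3 * k + 4) * pbeta_term p c (k + 2) n = Y n - Y (Suc n)" for n
  proof -
    have 1: "p ^ (3 * k + 4) = (p ^ k) ^ 3 * p ^ 4" "p ^ (2 * k + 2) = (p ^ k)\<^sup>2 * p\<^sup>2" "p ^ Suc k = p ^ k * p"
      by (simp_all only: power_add power_mult[symmetric] mult.commute power_Suc)
    have 2: "p ^ (n * (k + 2)) = p ^ (n * k) * (p ^ n)\<^sup>2" "p ^ (n * Suc k) = p ^ (n * k) * p ^ n"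
      by (simp_all only: power_add power_mult[symmetric] distrib_left mult_Suc_right mult.commute)
    have 3: "p ^ (Suc n * k) = p ^ (n * k) * p ^ k" "p ^ Suc n = p ^ n * p"
      by (simp_all add: power_add)
    show ?thesis
      unfolding Y_def pbeta_term_def 1 2 3
      by (rule certificate_triangle[OF ptheta_step2(2)[OF p] ptheta_three_term[OF p] c(3)])
  qed
  moreover have "fps_X ^ n dvd Y n" for n
    unfolding Y_def by (intro dvd_mult dvd_mult2 c)
  ultimately have "(\<lambda>n. pbeta_term p c k n - (p ^ Suc k - p ^ (2 * k + 2)) * pbeta_term p c (Suc k) n -
      p ^ (3 * k + 4) * pbeta_term p c (k + 2) n) sums Y 0"
    using fps_telescope_sums[of Y] by simp
  moreover have "Y 0 = (1 - p ^ (2 * k + 2)) * (ptheta p k 0 + p ^ Suc k * ptheta p (Suc k) 0)"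
    unfolding Y_def by (simp add: c power_add power_mult[of p 2, unfolded mult.commute[of 2]] power2_eq_square algebra_simps)
  moreover have "(\<lambda>n. pbeta_term p c k n - (p ^ Suc k - p ^ (2 * k + 2)) * pbeta_term p c (Suc k) n -
      p ^ (3 * k + 4) * pbeta_term p c (k + 2) n) sums
      (pbeta p c k - (p ^ Suc k - p ^ (2 * k + 2)) * pbeta p c (Suc k) -
    p ^ (3 * k + 4) * pbeta p c (k + 2))"
    by (intro fps_sums_diff_mult pbeta_sums p c)
  ultimately show ?thesis using ptheta_0[OF p, of k] sums_unique2 by fastforce
qed

lemma pbeta_sqrt:
  fixes r :: "int fps"
  assumes p: "fps_X dvd r\<^sup>2"
    and c: "\<And>n. fps_X ^ n dvd c n" "c 0 = 1" "\<And>n. c (Suc n) = - ((1 - r * (r\<^sup>2) ^ n) * r * (r\<^sup>2) ^ n * c n)"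
  shows "pbeta (r\<^sup>2) c k - r ^ (4 * k + 3) * pbeta (r\<^sup>2) c (Suc k) = 1 - r ^ (2 * k + 1)"
proof -
  define Y where "Y = (\<lambda>n. c n * (r\<^sup>2) ^ (n * k) * ((1 - r * (r\<^sup>2) ^ k * (r\<^sup>2) ^ n) * ptheta (r\<^sup>2) k (2 * n) +
      (r\<^sup>2 * (r\<^sup>2) ^ k * ((r\<^sup>2) ^ n)\<^sup>2 - r ^ 3 * ((r\<^sup>2) ^ k)\<^sup>2 * (r\<^sup>2) ^ n) * ptheta (r\<^sup>2) (Suc k) (2 * n)))"
  have pk: "(r\<^sup>2) ^ k = r ^ (2 * k)" by (simp add: power_mult)
  have "pbeta_term (r\<^sup>2) c k n - r ^ (4 * k + 3) * pbeta_term (r\<^sup>2) c (Suc k) n = Y n - Y (Suc n)" for n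
  proof -
    have 1: "r ^ (4 * k + 3) = r ^ 3 * ((r\<^sup>2) ^ k)\<^sup>2"
      unfolding pk by (simp flip: power_mult power_add) (simp add: algebra_simps)
    have 2: "(r\<^sup>2) ^ (n * Suc k) = (r\<^sup>2) ^ (n * k) * (r\<^sup>2) ^ n"
      by (simp add: power_add mult.commute)
    have 3: "(r\<^sup>2) ^ (Suc n * k) = (r\<^sup>2) ^ (n * k) * (r\<^sup>2) ^ k" "(r\<^sup>2) ^ Suc n = (r\<^sup>2) ^ n * r\<^sup>2"
      by (simp_all add: power_add)
    show ?thesis
      unfolding Y_def pbeta_term_def 1 2 3
      by (rule certificate_sqrt[OF ptheta_step2[OF p] c(3)])
  qed
  moreover have "fps_X ^ n dvd Y n" for n
    unfolding Y_def by (intro dvd_mult dvd_mult2 c)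
  ultimately have "(\<lambda>n. pbeta_term (r\<^sup>2) c k n - r ^ (4 * k + 3) * pbeta_term (r\<^sup>2) c (Suc k) n) sums Y 0"
    using fps_telescope_sums[of Y] by simp
  moreover have "Y 0 = (1 - r ^ (2 * k + 1)) * (ptheta (r\<^sup>2) k 0 + (r\<^sup>2) ^ Suc k * ptheta (r\<^sup>2) (Suc k) 0)"
    unfolding Y_def by (simp add: c pk) (simp add: power2_eq_square power3_eq_cube algebra_simps)
  moreover have "(\<lambda>n. pbeta_term (r\<^sup>2) c k n - r ^ (4 * k + 3) * pbeta_term (r\<^sup>2) c (Suc k) n) sums
      (pbeta (r\<^sup>2) c k - r ^ (4 * k + 3) * pbeta (r\<^sup>2) c (Suc k))"
    by (intro fps_sums_diff_mult pbeta_sums p c)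
  ultimately show ?thesis using ptheta_0[OF p, of k] sums_unique2 by fastforce
qed

section \<open>Evaluation of the weighted sums as partial theta series\<close>

lemma pbeta_rank_sums:
  fixes k :: nat
  defines "\<beta> \<equiv> pbeta fps_X (\<lambda>n. fps_X ^ n\<^sup>2)"
  shows "(\<lambda>j. fps_X ^ (3 * j\<^sup>2 + 3 * j * k + j) - fps_X ^ (3 * j\<^sup>2 + 3 * j * k + 5 * j + 2 * k + 2)) sums \<beta> k"
proof -
  \<comment> \<open>The remainder after \<open>j\<close> iterations: its exponent is the sum of 3 (k
    + 2 i) + 4 over i < j.\<close>
  define Y where "Y = (\<lambda>j. fps_X ^ (3 * j\<^sup>2 + 3 * j * k + j) * \<beta> (k + 2 * j))"
  have rec: "\<beta> k - fps_X ^ (3 * k + 4) * \<beta> (k + 2) = 1 - fps_X ^ (2 * k + 2)" for k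
    unfolding \<beta>_def
  proof (rule pbeta_square)
    show "fps_X ^ n dvd (fps_X :: int fps) ^ n\<^sup>2" for n
      by (intro dvd_power_of_dvd) (auto simp: power2_eq_square)
    show "(fps_X :: int fps) ^ (Suc n)\<^sup>2 = (fps_X ^ n)\<^sup>2 * fps_X * fps_X ^ n\<^sup>2" for n
      by (simp add: power2_eq_square power_add mult_ac)
  qed simp_all
  have "Y j - Y (Suc j) = fps_X ^ (3 * j\<^sup>2 + 3 * j * k + j) - fps_X ^ (3 * j\<^sup>2 + 3 * j * k + 5 * j + 2 * k + 2)"
    for j
  proof -
    have 1: "3 * (Suc j)\<^sup>2 + 3 * Suc j * k + Suc j = (3 * j\<^sup>2 + 3 * j * k + j) + (3 * (k + 2 * j) + 4)"
      and 2: "3 * j\<^sup>2 + 3 * j * k + 5 * j + 2 * k + 2 = (3 * j\<^sup>2 + 3 * j * k + j) + (2 * (k + 2 * j) + 2)"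
      and 3: "k + 2 * Suc j = k + 2 * j + 2"
      by (simp_all add: power2_eq_square algebra_simps)
    have "Y j - Y (Suc j) = fps_X ^ (3 * j\<^sup>2 + 3 * j * k + j) *
        (\<beta> (k + 2 * j) - fps_X ^ (3 * (k + 2 * j) + 4) * \<beta> (k + 2 * j + 2))"
      unfolding Y_def 1 3 power_add[of _ "3 * j\<^sup>2 + 3 * j * k + j"] by (simp only: right_diff_distrib mult.assoc)
    also have "\<dots> = fps_X ^ (3 * j\<^sup>2 + 3 * j * k + j) -
        fps_X ^ (3 * j\<^sup>2 + 3 * j * k + 5 * j + 2 * k + 2)"
      unfolding rec 2 power_add[of _ "3 * j\<^sup>2 + 3 * j * k + j"] by (simp only: right_diff_distrib mult_1_right)
    finally show ?thesis .
  qed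
  moreover have "fps_X ^ j dvd Y j" for j
    unfolding Y_def by (intro dvd_mult2 dvd_power_of_dvd) auto
  ultimately show ?thesis
    using fps_telescope_sums[of Y] by (simp add: Y_def)
qed

lemma pbeta_overpartition_sums:
  fixes k :: nat
  defines "\<beta> \<equiv> pbeta fps_X (\<lambda>n. qpoch (- 1) fps_X n * fps_X ^ (n * (n + 1) div 2))"
  shows "(\<lambda>m. 2 * (- 1) ^ m * fps_X ^ (m\<^sup>2 + (2 * k + 1) * m)) sums (\<beta> k - fps_X ^ Suc k * \<beta> (Suc k) + 1)"
proof -
  \<comment> \<open>This combination lowers the order of the recurrence from two to one, and the
    added 1 makes the inhomogeneity the constant 2.\<close>
  define E where "E = (\<lambda>k. \<beta> k - fps_X ^ Suc k * \<beta> (Suc k) + 1)"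
  define Y where "Y = (\<lambda>m. (- 1) ^ m * fps_X ^ (m\<^sup>2 + (2 * k + 1) * m) * E (k + m))"
  have rec: "E k + fps_X ^ (2 * k + 2) * E (Suc k) = 2" for k
  proof -
    have "\<beta> k - (fps_X ^ Suc k - fps_X ^ (2 * k + 2)) * \<beta> (Suc k) - fps_X ^ (3 * k + 4) * \<beta> (k + 2) =
        1 - fps_X ^ (2 * k + 2)"
      unfolding \<beta>_def
    proof (rule pbeta_triangle)
      show "fps_X ^ n dvd qpoch (- 1) fps_X n * (fps_X :: int fps) ^ (n * (n + 1) div 2)" for n
        by (intro dvd_mult dvd_power_of_dvd le_tri) auto
      show "qpoch (- 1) fps_X (Suc n) * (fps_X :: int fps) ^ (Suc n * (Suc n + 1) div 2) =
          (1 + fps_X ^ n) * fps_X ^ n * fps_X * (qpoch (- 1) fps_X n * fps_X ^ (n * (n + 1) div 2))" for n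
        unfolding tri_Suc qpoch_Suc by (simp add: power_add mult_ac)
    qed (simp_all add: qpoch_def)
    moreover have "fps_X ^ (3 * k + 4) = fps_X ^ (2 * k + 2) * (fps_X :: int fps) ^ Suc (Suc k)"
      by (simp flip: power_add add: numeral_eq_Suc)
    ultimately show ?thesis
      unfolding E_def by (simp add: algebra_simps)
  qed
  have "Y m - Y (Suc m) = 2 * (- 1) ^ m * fps_X ^ (m\<^sup>2 + (2 * k + 1) * m)" for m
  proof -
    have 1: "(Suc m)\<^sup>2 + (2 * k + 1) * Suc m = (m\<^sup>2 + (2 * k + 1) * m) + (2 * (k + m) + 2)"
      by (simp add: power2_eq_square algebra_simps)
    have "Y m - Y (Suc m) = (- 1) ^ m * fps_X ^ (m\<^sup>2 + (2 * k + 1) * m) *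
        (E (k + m) + fps_X ^ (2 * (k + m) + 2) * E (Suc (k + m)))"
      unfolding Y_def 1 power_add[of _ "m\<^sup>2 + (2 * k + 1) * m"] add_Suc_right
      by (simp only: distrib_left mult.assoc power_Suc mult_minus_left mult_minus_right mult_1_left diff_minus_eq_add minus_minus)
    then show ?thesis unfolding rec by (simp only: mult_ac)
  qed
  moreover have "fps_X ^ m dvd Y m" for m
    unfolding Y_def by (intro dvd_mult2 dvd_mult dvd_power_of_dvd) auto
  ultimately show ?thesis
    using fps_telescope_sums[of Y] by (simp add: Y_def E_def)
qed

lemma pbeta_M2_sums:
  fixes k :: nat
  defines "\<beta> \<equiv> pbeta (fps_X\<^sup>2) (\<lambda>n. (- 1) ^ n * fps_X ^ n\<^sup>2 * qpoch fps_X (fps_X\<^sup>2) n)"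
  shows "(\<lambda>m. (- 1) ^ m * fps_X ^ (m * (m + 1) div 2 + 2 * m * k)) sums \<beta> k"
proof -
  define h :: "nat \<Rightarrow> int fps" where "h = (\<lambda>m. (- 1) ^ m * fps_X ^ (m * (m + 1) div 2 + 2 * m * k))"
  \<comment> \<open>Each iteration contributes two consecutive terms of \<open>h\<close>, hence the
    index \<open>2 * m\<close> in the exponent, which is the sum of 4 (k + i) + 3 over i <
    m.\<close>
  define Y where "Y = (\<lambda>m. fps_X ^ (2 * m * (2 * m + 1) div 2 + 2 * (2 * m) * k) * \<beta> (k + m))"
  have rec: "\<beta> k - fps_X ^ (4 * k + 3) * \<beta> (Suc k) = 1 - fps_X ^ (2 * k + 1)" for k
    unfolding \<beta>_def
  proof (rule pbeta_sqrt)
    show "fps_X ^ n dvd (- 1) ^ n * (fps_X :: int fps) ^ n\<^sup>2 * qpoch fps_X (fps_X\<^sup>2) n" for n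
      by (intro dvd_mult2 dvd_mult dvd_power_of_dvd) (auto simp: power2_eq_square)
    show "(- 1) ^ Suc n * (fps_X :: int fps) ^ (Suc n)\<^sup>2 * qpoch fps_X (fps_X\<^sup>2) (Suc n) =
        - ((1 - fps_X * (fps_X\<^sup>2) ^ n) * fps_X * (fps_X\<^sup>2) ^ n *
           ((- 1) ^ n * fps_X ^ n\<^sup>2 * qpoch fps_X (fps_X\<^sup>2) n))" for n
    proof -
      have "(fps_X :: int fps) ^ (Suc n)\<^sup>2 = fps_X * (fps_X\<^sup>2) ^ n * fps_X ^ n\<^sup>2"
        by (simp add: power2_eq_square power_add power_mult_distrib mult_ac)
      then show ?thesis unfolding qpoch_Suc by (simp add: mult_ac)
    qed
  qed (simp_all add: qpoch_def power2_eq_square)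
  have "Y m - Y (Suc m) = h (2 * m) + h (Suc (2 * m))" for m
  proof -
    define e where "e = 2 * m * (2 * m + 1) div 2 + 2 * (2 * m) * k"
    have 1: "2 * Suc m * (2 * Suc m + 1) div 2 + 2 * (2 * Suc m) * k = e + (4 * (k + m) + 3)"
      unfolding e_def by (simp add: algebra_simps)
    have 2: "Suc (2 * m) * (Suc (2 * m) + 1) div 2 + 2 * Suc (2 * m) * k = e + (2 * (k + m) + 1)"
      unfolding e_def tri_Suc by (simp add: algebra_simps)
    have "Y m - Y (Suc m) = fps_X ^ e * (\<beta> (k + m) - fps_X ^ (4 * (k + m) + 3) * \<beta> (Suc (k + m)))"
      unfolding Y_def 1 power_add[of _ e] e_def[symmetric] add_Suc_right by (simp only: right_diff_distrib mult.assoc)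
    also have "\<dots> = h (2 * m) + h (Suc (2 * m))"
      unfolding rec h_def 2 power_add[of _ e] e_def[symmetric] by (simp add: right_diff_distrib)
    finally show ?thesis .
  qed
  moreover have "fps_X ^ m dvd Y m" for m
    unfolding Y_def by (intro dvd_mult2 dvd_mult dvd_power_of_dvd) auto
  ultimately have 1: "(\<lambda>m. h (2 * m) + h (2 * m + 1)) sums \<beta> k"
    using fps_telescope_sums[of Y] by (simp add: Y_def)
  \<comment> \<open>Convergence of the paired sums alone does not permit undoing the pairing;
    separate summability of both halves does.\<close>
  have "summable (\<lambda>m. h (2 * m))" "summable (\<lambda>m. h (2 * m + 1))"
    unfolding h_def by (intro fps_dvd_summable dvd_mult dvd_power_of_dvd trans_le_add1 order_trans[OF _ le_tri]; simp)+
  then obtain a b where "(\<lambda>m. h (2 * m)) sums a" "(\<lambda>m. h (2 * m + 1)) sums b"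
    by (auto simp: summable_def)
  with fps_sums_even_odd[of h a b] sums_unique2[OF 1 sums_add, of a b] show ?thesis
    by (simp add: h_def)
qed

section \<open>Coefficients with respect to \<open>z\<close>\<close>

text \<open>Exchanges the roles of the variables: reading off powers of \<open>z\<close> first
  leaves integer series in \<open>q\<close>, to which the recurrences above apply.\<close>

definition zcoeff :: "int \<Rightarrow> zq_series \<Rightarrow> int fps" where
  "zcoeff k f = Abs_fps (\<lambda>e. Poly_Mapping.lookup (fps_nth f e) k)"

lemma zcoeff_nth [simp]: "fps_nth (zcoeff k f) e = Poly_Mapping.lookup (fps_nth f e) k"
  by (simp add: zcoeff_def)

lemma zcoeff_eqI: "(\<And>k. zcoeff k f = zcoeff k g) \<Longrightarrow> f = g"
  by (intro fps_ext poly_mapping_eqI) (metis zcoeff_nth)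

lemma zcoeff_0 [simp]: "zcoeff k 0 = 0"
  by (intro fps_ext) simp

lemma zcoeff_1: "zcoeff k 1 = (if k = 0 then 1 else 0)"
  by (intro fps_ext) (auto simp: lookup_one)

lemma zcoeff_add: "zcoeff k (f + g) = zcoeff k f + zcoeff k g"
  by (intro fps_ext) (simp add: lookup_add)

lemma zcoeff_diff: "zcoeff k (f - g) = zcoeff k f - zcoeff k g"
  by (intro fps_ext) (simp add: lookup_minus)

lemma zcoeff_uminus: "zcoeff k (- f) = - zcoeff k f"
  by (intro fps_ext) (simp add: lookup_uminus)

lemma zcoeff_sum: "zcoeff k (sum f A) = (\<Sum>i\<in>A. zcoeff k (f i))"
  by (induction A rule: infinite_finite_induct) (simp_all add: zcoeff_add)

lemma lookup_single_times:
  "Poly_Mapping.lookup (Poly_Mapping.single a 1 * f) k = Poly_Mapping.lookup f (k - a)"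
  for f :: "int \<Rightarrow>\<^sub>0 int"
proof -
  have "Sum_any (\<lambda>i. Poly_Mapping.lookup f i when k = l + i) = Poly_Mapping.lookup f (k - l)" for l
  proof -
    have "k = l + i \<longleftrightarrow> i = k - l" for i by auto
    then show ?thesis by simp
  qed
  moreover have "Poly_Mapping.lookup (Poly_Mapping.single a 1) l * x = (x when a = l)" for l and x :: int
    by (simp add: lookup_single when_def)
  ultimately show ?thesis by (simp add: lookup_mult)
qed

lemma zcoeff_zpow: "zcoeff k (zpow a * f) = zcoeff (k - a) f"
  by (intro fps_ext) (simp add: zpow_def lookup_single_times)

lemma zcoeff_sums:
  assumes "f sums s"
  shows "(\<lambda>n. zcoeff k (f n)) sums zcoeff k s"
  unfolding sums_def zcoeff_sum[symmetric]
proof (rule tendsto_fpsI)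
  fix e
  have "\<forall>\<^sub>F n in sequentially. fps_nth (\<Sum>i<n. f i) e = fps_nth s e"
    using assms by (simp add: sums_def tendsto_fps_iff)
  then show "\<forall>\<^sub>F n in sequentially. fps_nth (zcoeff k (\<Sum>i<n. f i)) e = fps_nth (zcoeff k s) e"
    by eventually_elim simp
qed

lemma zcoeff_dvd: "q ^ m dvd f \<Longrightarrow> fps_X ^ m dvd zcoeff k f"
  by (simp add: fps_X_power_dvd_iff)

text \<open>\<open>zfree c c'\<close> says that \<open>c\<close> does not involve \<open>z\<close> and is \<open>c'\<close> as a series over the integers.\<close>

definition zfree :: "zq_series \<Rightarrow> int fps \<Rightarrow> bool" where
  "zfree c c' \<longleftrightarrow> (\<forall>k f. zcoeff k (c * f) = c' * zcoeff k f)"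

lemma zfreeD: "zfree c c' \<Longrightarrow> zcoeff k (c * f) = c' * zcoeff k f"
  by (simp add: zfree_def)

lemma zfree_1 [intro]: "zfree 1 1"
  by (simp add: zfree_def)

lemma zfree_X [intro]: "zfree q fps_X"
  unfolding zfree_def by (intro allI fps_ext) simp

lemma zfree_mult [intro]: "zfree c c' \<Longrightarrow> zfree d d' \<Longrightarrow> zfree (c * d) (c' * d')"
  by (simp add: zfree_def mult.assoc)

lemma zfree_diff [intro]: "zfree c c' \<Longrightarrow> zfree d d' \<Longrightarrow> zfree (c - d) (c' - d')"
  by (simp add: zfree_def left_diff_distrib zcoeff_diff)

lemma zfree_uminus [intro]: "zfree c c' \<Longrightarrow> zfree (- c) (- c')"
  by (simp add: zfree_def zcoeff_uminus)

lemma zfree_power [intro]: "zfree c c' \<Longrightarrow> zfree (c ^ n) (c' ^ n)"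
  by (induction n) auto

lemma zfree_qpoch [intro]:
  assumes "zfree a a'" "zfree p p'"
  shows "zfree (qpoch a p n) (qpoch a' p' n)"
proof (induction n)
  case 0
  show ?case by (simp add: qpoch_def zfree_1)
next
  case (Suc n)
  then show ?case unfolding qpoch_Suc by (intro zfree_mult zfree_diff zfree_1 zfree_power assms)
qed

lemma zcoeff_zfree: "zfree c c' \<Longrightarrow> zcoeff k c = (if k = 0 then c' else 0)"
  using zfreeD[of c c' k 1] by (simp add: zcoeff_1)

section \<open>Expansion of the products in powers of \<open>z\<close>\<close>

lemma qpoch_inf_cong:
  fixes a p :: zq_series
  assumes "q dvd a" "q dvd p"
  shows "q ^ n dvd qpoch_inf a p - qpoch a p n"
proof -
  have nth: "fps_nth a 0 = 0" "fps_nth p 0 = 0"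
    using assms fps_X_power_dvd_iff[of 1] by auto
  \<comment> \<open>\<open>has_prod\<close> permits finitely many leading zero factors; excluding
    them leaves the plain limit of partial products.\<close>
  have "1 - a * p ^ k \<noteq> 0" for k
  proof
    assume "1 - a * p ^ k = 0"
    then have "fps_nth (1 - a * p ^ k) 0 = 0" by simp
    with nth show False by simp
  qed
  then have "(\<lambda>m. \<Prod>k\<le>m. 1 - a * p ^ k) \<longlonglongrightarrow> qpoch_inf a p"
    using qpoch_inf_has_prod[OF nth] by (auto simp: has_prod_def raw_has_prod_def)
  then have lim: "(\<lambda>m. qpoch a p (Suc m) + - qpoch a p n) \<longlonglongrightarrow> qpoch_inf a p + - qpoch a p n"
    unfolding qpoch_def lessThan_Suc_atMost by (intro tendsto_add tendsto_const)
  have step: "q ^ n dvd qpoch a p m - qpoch a p n" if "m \<ge> n" for m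
    using that
  proof (induction m rule: dec_induct)
    case (step m)
    have "qpoch a p (Suc m) - qpoch a p n = (qpoch a p m - qpoch a p n) - qpoch a p m * a * p ^ m"
      by (simp add: qpoch_Suc algebra_simps)
    moreover have "q ^ n dvd qpoch a p m * a * p ^ m"
      by (intro dvd_mult dvd_power_of_dvd assms step)
    ultimately show ?case using dvd_diff[OF step.IH] by metis
  qed simp
  show ?thesis
    using fps_dvd_limit[OF lim, of n n] step by simp
qed

text \<open>
  \<open>theta_coeff p a b k\<close> is the coefficient of \<open>z\<^sup>k\<close> in
  \<open>(zp\<^sup>a\<^sup>+\<^sup>1;p)\<^sub>\<infinity> (z\<^sup>-\<^sup>1p\<^sup>b\<^sup>+\<^sup>1;p)\<^sub>\<infinity> (p;p)\<^sub>\<infinity>\<close>. Having two indices \<open>a\<close>, \<open>b\<close> allows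
  removing one factor at a time, so that each step is a single rule for \<open>ptheta\<close>.
\<close>

definition theta_coeff :: "int fps \<Rightarrow> nat \<Rightarrow> nat \<Rightarrow> int \<Rightarrow> int fps" where
  "theta_coeff p a b k = (let j = nat \<bar>k\<bar> in
     (- 1) ^ j * p ^ (j * (j + 1) div 2 + (if k \<ge> 0 then a else b) * j) * ptheta p j (a + b))"

lemma theta_coeff_nonneg:
  "theta_coeff p a b (int j) = (- 1) ^ j * p ^ (j * (j + 1) div 2 + a * j) * ptheta p j (a + b)"
  by (simp add: theta_coeff_def)

lemma theta_coeff_nonpos:
  "theta_coeff p a b (- int j) = (- 1) ^ j * p ^ (j * (j + 1) div 2 + b * j) * ptheta p j (a + b)"
  by (cases "j = 0") (simp_all add: theta_coeff_def)

lemma theta_coeff_sym: "theta_coeff p a b k = theta_coeff p b a (- k)"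
  by (cases k rule: int_cases2) (simp_all add: theta_coeff_nonneg theta_coeff_nonpos add.commute)

text \<open>Corresponds to the factor 1 - z p^(a+1). For \<open>k \<ge> 1\<close> the step to
  \<open>k - 1\<close> lowers the absolute value and is \<open>ptheta_Suc\<close>; for
  \<open>k \<le> 0\<close> it raises it and is \<open>ptheta_Suc'\<close>.\<close>

lemma theta_coeff_left:
  assumes p: "fps_X dvd p"
  shows "theta_coeff p a b k = theta_coeff p (Suc a) b k - p ^ Suc a * theta_coeff p (Suc a) b (k - 1)"
proof (cases "k \<ge> 1")
  case True
  define j where "j = nat (k - 1)"
  have k: "k = int (Suc j)" using True by (simp add: j_def)
  have k1: "k - 1 = int j" by (simp add: k)
  define e where "e = j * (j + 1) div 2 + Suc j + a * Suc j"
  have 1: "Suc j * (Suc j + 1) div 2 + a * Suc j = e" "Suc j * (Suc j + 1) div 2 + Suc a * Suc j = e + Suc j"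
    and 2: "Suc a + (j * (j + 1) div 2 + Suc a * j) = e"
    unfolding tri_Suc e_def by simp_all
  have "p ^ Suc a * theta_coeff p (Suc a) b (k - 1) = (- 1) ^ j * p ^ e * ptheta p j (Suc (a + b))"
    unfolding k1 theta_coeff_nonneg 2[symmetric] power_add by (simp add: mult_ac)
  then show ?thesis
    unfolding k theta_coeff_nonneg 1 using ptheta_Suc[OF p, of j "a + b"]
    by (simp add: k[symmetric] power_add algebra_simps)
next
  case False
  define j where "j = nat (- k)"
  have k: "k = - int j" using False by (simp add: j_def)
  have k1: "k - 1 = - int (Suc j)" by (simp add: k)
  define e where "e = j * (j + 1) div 2 + b * j"
  have 2: "Suc a + (Suc j * (Suc j + 1) div 2 + b * Suc j) = e + (j + (a + b) + 2)"
    unfolding tri_Suc e_def by simp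
  have "p ^ Suc a * theta_coeff p (Suc a) b (k - 1) =
      - ((- 1) ^ j * p ^ e * (p ^ (j + (a + b) + 2) * ptheta p (Suc j) (Suc (a + b))))"
  proof -
    have "p ^ Suc a * theta_coeff p (Suc a) b (k - 1) =
        (- 1) ^ Suc j * p ^ (Suc a + (Suc j * (Suc j + 1) div 2 + b * Suc j)) * ptheta p (Suc j) (Suc (a + b))"
      unfolding k1 theta_coeff_nonpos power_add by (simp add: mult_ac del: mult_Suc mult_Suc_right)
    then show ?thesis unfolding 2 power_add[of _ e] by (simp only: power_Suc mult_minus_left mult_1_left mult.assoc)
  qed
  then show ?thesis
    unfolding k theta_coeff_nonpos e_def[symmetric] using ptheta_Suc'[OF p, of j "a + b"]
    by (simp add: k[symmetric] right_diff_distrib del: power_Suc)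
qed

lemma theta_coeff_step:
  assumes p: "fps_X dvd p"
  shows "theta_coeff p n n k = (1 + p ^ (2 * n + 2)) * theta_coeff p (Suc n) (Suc n) k -
    p ^ Suc n * (theta_coeff p (Suc n) (Suc n) (k - 1) + theta_coeff p (Suc n) (Suc n) (k + 1))"
proof -
  \<comment> \<open>The factor with 1/z, obtained through the symmetry that swaps \<open>a\<close>
    with \<open>b\<close> and \<open>k\<close> with \<open>- k\<close>.\<close>
  have right: "theta_coeff p a b k = theta_coeff p a (Suc b) k - p ^ Suc b * theta_coeff p a (Suc b) (k + 1)"
    for a b k
    using theta_coeff_left[OF p, of b a "- k"] theta_coeff_sym[of p b a "- k"]
      theta_coeff_sym[of p "Suc b" a "- k"] theta_coeff_sym[of p "Suc b" a "- k - 1"]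
    by (simp add: add.commute[of 1 k])
  have "p ^ (2 * n + 2) = p ^ Suc n * p ^ Suc n"
    by (simp add: power_add mult_2)
  then show ?thesis
    unfolding theta_coeff_left[OF p, of n n k] right[of "Suc n" n]
    by (simp only:) (simp add: algebra_simps del: power_Suc)
qed

text \<open>For \<open>k \<noteq> 0\<close> the explicit power of \<open>p\<close> is already at
  least \<open>n\<close>. For \<open>k = 0\<close> the product from \<open>ptheta_cong_qpoch\<close>
  is cut down to \<open>n\<close> factors, the others being 1 modulo
  \<open>fps_X ^ n\<close>.\<close>

lemma theta_coeff_cong:
  assumes p: "fps_X dvd p"
  shows "fps_X ^ n dvd theta_coeff p (Suc n) (Suc n) k - (if k = 0 then qpoch p p n else 0)"
proof (cases "k = 0")
  case True
  have "fps_X ^ Suc (2 * n) dvd ptheta p 0 (2 * Suc n) - qpoch p p (Suc (2 * n))"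
    using ptheta_cong_qpoch[OF p, of "Suc (2 * n)"] by simp
  then have 1: "fps_X ^ n dvd ptheta p 0 (2 * Suc n) - qpoch p p (Suc (2 * n))"
    by (rule power_le_dvd) simp
  have 2: "fps_X ^ n dvd qpoch p p (n + m) - qpoch p p n" for m
  proof (induction m)
    case (Suc m)
    have "qpoch p p (n + Suc m) - qpoch p p n = (qpoch p p (n + m) - qpoch p p n) - qpoch p p (n + m) * p * p ^ (n + m)"
      by (simp add: qpoch_Suc algebra_simps)
    moreover have "fps_X ^ n dvd qpoch p p (n + m) * p * p ^ (n + m)"
      by (intro dvd_mult dvd_power_of_dvd p) simp
    ultimately show ?case using dvd_diff[OF Suc] by metis
  qed simp
  have "theta_coeff p (Suc n) (Suc n) 0 = ptheta p 0 (2 * Suc n)"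
    by (simp add: theta_coeff_def mult_2)
  then show ?thesis
    using dvd_add[OF 1 2[of "Suc n"]] True by (simp add: mult_2)
next
  case False
  define j where "j = nat \<bar>k\<bar>"
  have "n \<le> j * (j + 1) div 2 + Suc n * j"
    using False by (cases j) (simp_all add: j_def)
  then have "fps_X ^ n dvd (- 1) ^ j * p ^ (j * (j + 1) div 2 + Suc n * j) * ptheta p j (Suc n + Suc n)"
    by (intro dvd_mult2 dvd_mult dvd_power_of_dvd p)
  then show ?thesis
    using False by (simp only: theta_coeff_def Let_def j_def if_cancel if_False diff_0_right)
qed

section \<open>Tails of the triple product and their coefficients\<close>

definition qdenom :: "zq_series \<Rightarrow> nat \<Rightarrow> zq_series" where
  "qdenom p n = qpoch (zpow 1 * p) p n * qpoch (zpow (- 1) * p) p n"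

definition triple_prod :: "zq_series \<Rightarrow> zq_series" where
  "triple_prod p = qpoch_inf (zpow 1 * p) p * qpoch_inf (zpow (- 1) * p) p * qpoch_inf p p"

text \<open>The tail W_n as a quotient, so that it is by construction what a summand with this
  denominator leaves behind.\<close>

definition tail_prod :: "zq_series \<Rightarrow> nat \<Rightarrow> zq_series" where
  "tail_prod p n = fps_quot (triple_prod p) (qdenom p n)"

lemma triple_prod_quot: "triple_prod p * fps_quot f (qdenom p n) = f * tail_prod p n"
  by (simp add: tail_prod_def fps_quot_def mult_ac)

lemma zcoeff_one_minus_zpow:
  assumes "zfree p p'"
  shows "zcoeff k ((1 - zpow a * p) * f) = zcoeff k f - p' * zcoeff (k - a) f"
  using zfreeD[OF assms] by (simp add: left_diff_distrib zcoeff_diff zcoeff_zpow mult.assoc)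

lemma fps_dvd_cancel_unit:
  fixes f g :: zq_series
  assumes "fps_nth g 0 = 1" "q ^ n dvd f * g"
  shows "q ^ n dvd f"
proof -
  have "f = fps_quot 1 g * (f * g)"
    using fps_quot_mult[OF assms(1), of 1] by (simp add: mult_ac)
  then show ?thesis using assms(2) dvd_mult by metis
qed

text \<open>Both sides obey the same recurrence from \<open>n + 1\<close> to \<open>n\<close> and
  agree to order \<open>n\<close> at index \<open>n + 1\<close>. The recurrence carries the
  agreement down from arbitrarily large indices, so the difference \<open>e\<close>
  vanishes.\<close>

lemma zcoeff_tail_prod:
  assumes p: "q dvd p" "fps_X dvd p'" "zfree p p'"
  shows "zcoeff k (tail_prod p n) = theta_coeff p' n n k"
proof -
  have p0: "fps_nth p 0 = 0" using p(1) fps_X_power_dvd_iff[of 1 p] by simp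
  have denom_0: "fps_nth (qdenom p n) 0 = 1" for n
    by (simp add: qdenom_def qpoch_nth_0 p0)
  note tail = fps_quot_mult[OF denom_0, of "triple_prod p", folded tail_prod_def]
  have step: "tail_prod p n = (1 - zpow 1 * p ^ Suc n) * ((1 - zpow (- 1) * p ^ Suc n) * tail_prod p (Suc n))" for n
  proof -
    have "qdenom p (Suc n) = (1 - zpow 1 * p ^ Suc n) * (1 - zpow (- 1) * p ^ Suc n) * qdenom p n"
      by (simp add: qdenom_def qpoch_Suc mult_ac)
    with tail[of n] tail[of "Suc n"]
    have "((1 - zpow 1 * p ^ Suc n) * ((1 - zpow (- 1) * p ^ Suc n) * tail_prod p (Suc n))) * qdenom p n =
        tail_prod p n * qdenom p n"
      by (simp only: mult_ac)
    then have "((1 - zpow 1 * p ^ Suc n) * ((1 - zpow (- 1) * p ^ Suc n) * tail_prod p (Suc n))) *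
        (qdenom p n * fps_quot 1 (qdenom p n)) = tail_prod p n * (qdenom p n * fps_quot 1 (qdenom p n))"
      by (simp only: mult.assoc[symmetric])
    then show ?thesis
      using fps_quot_mult[OF denom_0, of 1 n] by (simp only: mult.commute[of "qdenom p n"] mult_1_right)
  qed
  define e where "e n k = zcoeff k (tail_prod p n) - theta_coeff p' n n k" for n k
  have e_step: "e n k = (1 + p' ^ (2 * n + 2)) * e (Suc n) k - p' ^ Suc n * (e (Suc n) (k - 1) + e (Suc n) (k + 1))"
    for n k
  proof -
    note z = zcoeff_one_minus_zpow[OF zfree_power[OF p(3)]]
    have "p' ^ (2 * n + 2) = p' ^ Suc n * p' ^ Suc n"
      by (simp add: power_add mult_2)
    then have "zcoeff k (tail_prod p n) = (1 + p' ^ (2 * n + 2)) * zcoeff k (tail_prod p (Suc n)) -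
      p' ^ Suc n * (zcoeff (k - 1) (tail_prod p (Suc n)) + zcoeff (k + 1) (tail_prod p (Suc n)))"
      unfolding step[of n] z by (simp only:) (simp add: algebra_simps del: power_Suc)
    then show ?thesis
      unfolding e_def theta_coeff_step[OF p(2), of n k] by (simp only:) (simp add: algebra_simps)
  qed
  have limit: "fps_X ^ n dvd e (Suc n) k" for n k
  proof -
    \<comment> \<open>Multiplied by the denominator, a unit, this compares a product of three
      infinite products with that of their truncations; the difference is expanded one factor at a
      time.\<close>
    have cong: "q ^ Suc n dvd tail_prod p (Suc n) - qpoch p p (Suc n)"
    proof (rule fps_dvd_cancel_unit[OF denom_0])
      define A B C where "A = qpoch_inf (zpow 1 * p) p" and "B = qpoch_inf (zpow (- 1) * p) p"
        and "C = qpoch_inf p p"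
      define A' B' C' where "A' = qpoch (zpow 1 * p) p (Suc n)" and "B' = qpoch (zpow (- 1) * p) p (Suc n)"
        and "C' = qpoch p p (Suc n)"
      have "q ^ Suc n dvd A - A'" "q ^ Suc n dvd B - B'" "q ^ Suc n dvd C - C'"
        unfolding A_def A'_def B_def B'_def C_def C'_def by (intro qpoch_inf_cong p dvd_mult)+
      then have "q ^ Suc n dvd (A - A') * (B * C) + A' * ((B - B') * C + B' * (C - C'))"
        by (intro dvd_add dvd_mult dvd_mult2)
      moreover have "(A - A') * (B * C) + A' * ((B - B') * C + B' * (C - C')) =
          (tail_prod p (Suc n) - C') * qdenom p (Suc n)"
        unfolding left_diff_distrib[of _ _ "qdenom p (Suc n)"] tail
        unfolding triple_prod_def qdenom_def A_def[symmetric] B_def[symmetric] C_def[symmetric]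
          A'_def[symmetric] B'_def[symmetric] C'_def[symmetric] by (simp add: algebra_simps)
      ultimately show "q ^ Suc n dvd (tail_prod p (Suc n) - qpoch p p (Suc n)) * qdenom p (Suc n)"
        by (simp add: C'_def)
    qed
    have 1: "fps_X ^ n dvd zcoeff k (tail_prod p (Suc n)) - (if k = 0 then qpoch p' p' (Suc n) else 0)"
      using power_le_dvd[OF zcoeff_dvd[OF cong, of k], of n]
      by (simp add: zcoeff_diff zcoeff_zfree[OF zfree_qpoch[OF p(3) p(3)]])
    have 2: "fps_X ^ n dvd (if k = 0 then qpoch p' p' (Suc n) else 0) - (if k = 0 then qpoch p' p' n else 0)"
      using dvd_power_of_dvd[OF p(2), of n n] by (simp add: qpoch_Suc right_diff_distrib)
    from dvd_diff[OF dvd_add[OF 1 2] theta_coeff_cong[OF p(2), of n k]]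
    show ?thesis unfolding e_def by simp
  qed
  have "fps_X ^ m dvd e n k" if "n \<le> Suc m" for m n k
    using that
  proof (induction n arbitrary: k rule: inc_induct)
    case base
    show ?case by (rule limit)
  next
    case (step n)
    show ?case unfolding e_step[of n k] by (intro dvd_diff dvd_mult dvd_add step)
  qed
  then have "fps_X ^ (n + Suc i) dvd e n k" for i by (simp del: power_Suc)
  then have "fps_nth (e n k) i = 0" for i
    using fps_X_power_dvd_iff[of "n + Suc i" "e n k"] by (simp del: power_Suc)
  then have "e n k = 0" by (intro fps_ext) simp
  then show ?thesis by (simp add: e_def)
qed

text \<open>In \<open>theta_coeff p' n n k\<close> only the power with exponent n |k| and the
  \<open>ptheta\<close> factor depend on \<open>n\<close>; these form the \<open>pbeta\<close>
  summand, and the sign and the triangular power come out of the sum.\<close>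

lemma zcoeff_triple_prod_series:
  assumes p: "q dvd p" "fps_X dvd p'" "zfree p p'"
    and c: "\<And>n. zfree (c n) (c' n)" "\<And>n. fps_X ^ n dvd c' n"
    and T: "\<And>n. T n = fps_quot (c n) (qdenom p n)" "summable T"
  shows "zcoeff k (triple_prod p * suminf T) =
    (- 1) ^ nat \<bar>k\<bar> * p' ^ (nat \<bar>k\<bar> * (nat \<bar>k\<bar> + 1) div 2) * pbeta p' c' (nat \<bar>k\<bar>)"
proof -
  define j where "j = nat \<bar>k\<bar>"
  have "(\<lambda>n. zcoeff k (triple_prod p * T n)) sums zcoeff k (triple_prod p * suminf T)"
    by (intro zcoeff_sums fps_sums_mult summable_sums T)
  moreover have "zcoeff k (triple_prod p * T n) = (- 1) ^ j * p' ^ (j * (j + 1) div 2) * pbeta_term p' c' j n" for n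
    unfolding T(1) triple_prod_quot zfreeD[OF c(1)] zcoeff_tail_prod[OF p] pbeta_term_def
    by (simp only: theta_coeff_def j_def[symmetric] Let_def power_add mult_2 mult_2_right if_cancel mult_ac)
  ultimately have "(\<lambda>n. (- 1) ^ j * p' ^ (j * (j + 1) div 2) * pbeta_term p' c' j n) sums zcoeff k (triple_prod p * suminf T)"
    by simp
  moreover have "(\<lambda>n. (- 1) ^ j * p' ^ (j * (j + 1) div 2) * pbeta_term p' c' j n) sums
      ((- 1) ^ j * p' ^ (j * (j + 1) div 2) * pbeta p' c' j)"
    by (intro fps_sums_mult pbeta_sums p c)
  ultimately show ?thesis unfolding j_def by (rule sums_unique2)
qed

section \<open>The Hecke--Rogers double sums\<close>

lemma zcoeff_monomial:
  "zcoeff k ((- 1) ^ i * zpow a * qhalf e) = (if k = a then (- 1) ^ i * fps_X ^ nat (e div 2) else 0)"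
proof -
  have "zcoeff k ((- 1) ^ i * (q ^ nat (e div 2) * (zpow a * 1))) =
      (- 1) ^ i * (fps_X ^ nat (e div 2) * zcoeff (k - a) 1)"
    by (simp only: zfreeD[OF zfree_power[OF zfree_uminus[OF zfree_1]]] zfreeD[OF zfree_power[OF zfree_X]] zcoeff_zpow)
  then show ?thesis by (simp add: qhalf_def zcoeff_1 mult_ac)
qed

text \<open>A fixed power of \<open>z\<close> selects from a double sum only a line of index pairs,
  with at most one \<open>j\<close> for each \<open>n\<close>; the line is parametrised by
  \<open>i\<close>.\<close>

lemma sums_indicator_reindex:
  fixes F :: "nat \<Rightarrow> nat \<Rightarrow> 'a::comm_ring_1 fps"
  assumes "(\<lambda>i. F (\<phi> i) (\<psi> i)) sums s" "strict_mono \<phi>" "\<And>n. finite (J n)"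
    and iff: "\<And>n j. j \<in> J n \<and> P n j \<longleftrightarrow> (\<exists>i. n = \<phi> i \<and> j = \<psi> i)"
  shows "(\<lambda>n. \<Sum>j\<in>J n. if P n j then F n j else 0) sums s"
proof (subst sums_mono_reindex[OF assms(2), symmetric])
  show "(\<Sum>j\<in>J n. if P n j then F n j else 0) = 0" if "n \<notin> range \<phi>" for n
    using that iff[of _ n] by (intro sum.neutral) auto
  have "(\<Sum>j\<in>J (\<phi> i). if P (\<phi> i) j then F (\<phi> i) j else 0) = F (\<phi> i) (\<psi> i)" for i
  proof -
    have "j \<in> J (\<phi> i) \<and> P (\<phi> i) j \<longleftrightarrow> j = \<psi> i" for j
      using iff[of j "\<phi> i"] strict_mono_eq[OF assms(2)] by auto
    then have "{j \<in> J (\<phi> i). P (\<phi> i) j} = {\<psi> i}" by auto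
    then show ?thesis using assms(3) by (simp add: sum.inter_filter[symmetric])
  qed
  with assms(1) show "(\<lambda>i. \<Sum>j\<in>J (\<phi> i). if P (\<phi> i) j then F (\<phi> i) j else 0) sums s"
    by simp
qed

lemma sum_abs_symmetric:
  fixes f :: "int \<Rightarrow> 'a::comm_ring_1"
  shows "(\<Sum>m\<in>{- int N..int N}. f \<bar>m\<bar>) = (\<Sum>j\<in>{0..N}. (if j = 0 then 1 else 2) * f (int j))"
proof (induction N)
  case (Suc N)
  have "{- int (Suc N)..int (Suc N)} = insert (int (Suc N)) (insert (- int (Suc N)) {- int N..int N})"
    by auto
  then show ?case using Suc by (simp add: algebra_simps)
qed simp

lemma tri_int: "2 * int (k * (k + 1) div 2) = int k * (int k + 1)"
proof -
  have "2 * (k * (k + 1) div 2) = k * (k + 1)" by simp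
  then show ?thesis by (metis of_nat_1 of_nat_add of_nat_mult of_nat_numeral)
qed

lemma nat_half: "e = 2 * int c \<Longrightarrow> nat (e div 2) = c"
  by simp

lemma minus_one_power_cong: "even (i + j) \<Longrightarrow> (- 1) ^ i = (- 1 :: 'a::ring_1) ^ j"
  by (simp add: minus_one_power_iff)

lemma zcoeff_rhs1_term:
  "zcoeff k (rhs1_term n) =
    (\<Sum>j\<in>{0..n div 2}. if k = int n - 3 * int j
       then (- 1) ^ (n + j) * fps_X ^ nat ((((int n)\<^sup>2 - 3 * (int j)\<^sup>2) + (int n - int j)) div 2) else 0) +
    (\<Sum>j\<in>{0..n div 2}. if k = 3 * int j - int n
       then (- 1) ^ (n + j) * fps_X ^ nat ((((int n)\<^sup>2 - 3 * (int j)\<^sup>2) + (int n - int j)) div 2) else 0) +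
    ((\<Sum>j\<in>{1..n div 2}. if k = int n - 3 * int j + 1
       then (- 1) ^ (n + j) * fps_X ^ nat ((((int n)\<^sup>2 - 3 * (int j)\<^sup>2) + (int n + int j)) div 2) else 0) +
     (\<Sum>j\<in>{1..n div 2}. if k = 3 * int j - int n - 1
       then (- 1) ^ (n + j) * fps_X ^ nat ((((int n)\<^sup>2 - 3 * (int j)\<^sup>2) + (int n + int j)) div 2) else 0))"
  unfolding rhs1_term_def distrib_left distrib_right zcoeff_add zcoeff_sum zcoeff_monomial sum.distrib ..

lemma zcoeff_rhs1_term_uminus: "zcoeff (- k) (rhs1_term n) = zcoeff k (rhs1_term n)"
proof -
  have "- k = int n - 3 * int j \<longleftrightarrow> k = 3 * int j - int n"
    "- k = 3 * int j - int n \<longleftrightarrow> k = int n - 3 * int j"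
    "- k = int n - 3 * int j + 1 \<longleftrightarrow> k = 3 * int j - int n - 1"
    "- k = 3 * int j - int n - 1 \<longleftrightarrow> k = int n - 3 * int j + 1" for j
    by auto
  then show ?thesis unfolding zcoeff_rhs1_term by (simp only: add_ac)
qed

text \<open>Each of the two double sums meets z^k along two lines with equal contributions, which
  accounts for the factor 2. The first double sum gives the positive terms \<open>f\<close> of
  \<open>pbeta_rank_sums\<close>, the second the negative terms \<open>g\<close>.\<close>

lemma zcoeff_rhs1:
  "zcoeff (int k) (suminf rhs1_term) =
    2 * ((- 1) ^ k * fps_X ^ (k * (k + 1) div 2) * pbeta fps_X (\<lambda>n. fps_X ^ n\<^sup>2) k)"
proof -
  define S where "S = (- 1 :: int fps) ^ k * fps_X ^ (k * (k + 1) div 2)"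
  define f g :: "nat \<Rightarrow> int fps" where "f = (\<lambda>i. fps_X ^ (3 * i\<^sup>2 + 3 * i * k + i))"
    and "g = (\<lambda>i. fps_X ^ (3 * i\<^sup>2 + 3 * i * k + 5 * i + 2 * k + 2))"
  have "summable f" "summable g"
    unfolding f_def g_def by (intro fps_dvd_summable dvd_power_of_dvd; simp)+
  then obtain a b where a: "f sums a" and b: "g sums b" by (auto simp: summable_def)
  have ab: "a + (- 1) * b = pbeta fps_X (\<lambda>n. fps_X ^ n\<^sup>2) k"
    using sums_unique2[OF sums_add[OF a fps_sums_mult[OF b, of "- 1"]], of "pbeta fps_X (\<lambda>n. fps_X ^ n\<^sup>2) k"]
      pbeta_rank_sums[of k] by (simp add: f_def g_def)
  define F where "F n j = (- 1 :: int fps) ^ (n + j) * fps_X ^ nat ((((int n)\<^sup>2 - 3 * (int j)\<^sup>2) + (int n - int j)) div 2)" for n j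
  define G where "G n j = (- 1 :: int fps) ^ (n + j) * fps_X ^ nat ((((int n)\<^sup>2 - 3 * (int j)\<^sup>2) + (int n + int j)) div 2)" for n j
  note t = tri_int[of k]
  have F: "F (3 * i + k) i = S * f i" "F (3 * i + 2 * k) (k + i) = S * f i" for i
  proof -
    have 1: "nat ((((int (3 * i + k))\<^sup>2 - 3 * (int i)\<^sup>2) + (int (3 * i + k) - int i)) div 2) =
        k * (k + 1) div 2 + (3 * i\<^sup>2 + 3 * i * k + i)"
      using t by (intro nat_half) (simp add: power2_eq_square algebra_simps)
    have 2: "nat ((((int (3 * i + 2 * k))\<^sup>2 - 3 * (int (k + i))\<^sup>2) + (int (3 * i + 2 * k) - int (k + i))) div 2) =
        k * (k + 1) div 2 + (3 * i\<^sup>2 + 3 * i * k + i)"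
      using t by (intro nat_half) (simp add: power2_eq_square algebra_simps)
    have 3: "(- 1 :: int fps) ^ (3 * i + k + i) = (- 1) ^ k" "(- 1 :: int fps) ^ (3 * i + 2 * k + (k + i)) = (- 1) ^ k"
      by (rule minus_one_power_cong; simp)+
    show "F (3 * i + k) i = S * f i" "F (3 * i + 2 * k) (k + i) = S * f i"
      unfolding F_def S_def f_def 1 2 3 power_add[of fps_X "k * (k + 1) div 2"] by (simp_all only: mult.assoc)
  qed
  have G: "G (3 * i + k + 2) (i + 1) = S * (- 1 * g i)" "G (3 * i + 2 * k + 2) (k + i + 1) = S * (- 1 * g i)" for i
  proof -
    have 1: "nat ((((int (3 * i + k + 2))\<^sup>2 - 3 * (int (i + 1))\<^sup>2) + (int (3 * i + k + 2) + int (i + 1))) div 2) =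
        k * (k + 1) div 2 + (3 * i\<^sup>2 + 3 * i * k + 5 * i + 2 * k + 2)"
      using t by (intro nat_half) (simp add: power2_eq_square algebra_simps)
    have 2: "nat ((((int (3 * i + 2 * k + 2))\<^sup>2 - 3 * (int (k + i + 1))\<^sup>2) + (int (3 * i + 2 * k + 2) + int (k + i + 1))) div 2) =
        k * (k + 1) div 2 + (3 * i\<^sup>2 + 3 * i * k + 5 * i + 2 * k + 2)"
      using t by (intro nat_half) (simp add: power2_eq_square algebra_simps)
    have 3: "(- 1 :: int fps) ^ (3 * i + k + 2 + (i + 1)) = (- 1) ^ Suc k"
      "(- 1 :: int fps) ^ (3 * i + 2 * k + 2 + (k + i + 1)) = (- 1) ^ Suc k"
      by (rule minus_one_power_cong; simp)+
    show "G (3 * i + k + 2) (i + 1) = S * (- 1 * g i)" "G (3 * i + 2 * k + 2) (k + i + 1) = S * (- 1 * g i)"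
      unfolding G_def S_def g_def 1 2 3 power_add[of fps_X "k * (k + 1) div 2"] by simp_all
  qed
  have f_sums: "(\<lambda>i. S * f i) sums (S * a)" and g_sums: "(\<lambda>i. S * (- 1 * g i)) sums (S * (- 1 * b))"
    by (intro fps_sums_mult a b)+
  have "(\<lambda>n. \<Sum>j\<in>{0..n div 2}. if int k = int n - 3 * int j then F n j else 0) sums (S * a)"
  proof (rule sums_indicator_reindex)
    show "(\<lambda>i. F (3 * i + k) i) sums (S * a)" unfolding F by (rule f_sums)
    show "j \<in> {0..n div 2} \<and> int k = int n - 3 * int j \<longleftrightarrow> (\<exists>i. n = 3 * i + k \<and> j = i)" for n j
      by auto
  qed (auto simp: strict_mono_def)
  moreover have "(\<lambda>n. \<Sum>j\<in>{0..n div 2}. if int k = 3 * int j - int n then F n j else 0) sums (S * a)"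
  proof (rule sums_indicator_reindex)
    show "(\<lambda>i. F (3 * i + 2 * k) (k + i)) sums (S * a)" unfolding F by (rule f_sums)
    \<comment> \<open>On this line the bound \<open>j \<le> n div 2\<close> amounts to
      \<open>k \<le> j\<close>, so \<open>j - k\<close> is a faithful witness.\<close>
    show "j \<in> {0..n div 2} \<and> int k = 3 * int j - int n \<longleftrightarrow> (\<exists>i. n = 3 * i + 2 * k \<and> j = k + i)" for n j
      by (auto intro!: exI[of _ "j - k"])
  qed (auto simp: strict_mono_def)
  moreover have "(\<lambda>n. \<Sum>j\<in>{1..n div 2}. if int k = int n - 3 * int j + 1 then G n j else 0) sums (S * (- 1 * b))"
  proof (rule sums_indicator_reindex)
    show "(\<lambda>i. G (3 * i + k + 2) (i + 1)) sums (S * (- 1 * b))" unfolding G by (rule g_sums)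
    show "j \<in> {1..n div 2} \<and> int k = int n - 3 * int j + 1 \<longleftrightarrow> (\<exists>i. n = 3 * i + k + 2 \<and> j = i + 1)" for n j
      by (auto intro!: exI[of _ "j - 1"])
  qed (auto simp: strict_mono_def)
  moreover have "(\<lambda>n. \<Sum>j\<in>{1..n div 2}. if int k = 3 * int j - int n - 1 then G n j else 0) sums (S * (- 1 * b))"
  proof (rule sums_indicator_reindex)
    show "(\<lambda>i. G (3 * i + 2 * k + 2) (k + i + 1)) sums (S * (- 1 * b))" unfolding G by (rule g_sums)
    show "j \<in> {1..n div 2} \<and> int k = 3 * int j - int n - 1 \<longleftrightarrow> (\<exists>i. n = 3 * i + 2 * k + 2 \<and> j = k + i + 1)" for n j
      by (auto intro!: exI[of _ "j - 1 - k"])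
  qed (auto simp: strict_mono_def)
  ultimately have "(\<lambda>n. zcoeff (int k) (rhs1_term n)) sums (S * a + S * a + (S * (- 1 * b) + S * (- 1 * b)))"
    unfolding zcoeff_rhs1_term F_def G_def by (intro sums_add)
  moreover have "(\<lambda>n. zcoeff (int k) (rhs1_term n)) sums zcoeff (int k) (suminf rhs1_term)"
    by (intro zcoeff_sums summable_sums summable_terms)
  ultimately have "zcoeff (int k) (suminf rhs1_term) = S * a + S * a + (S * (- 1 * b) + S * (- 1 * b))"
    using sums_unique2 by blast
  also have "\<dots> = 2 * (S * (a + (- 1) * b))" by (simp add: algebra_simps)
  finally show ?thesis unfolding ab S_def by simp
qed

lemma zfree_weight: "zfree (if j = 0 then 1 else 2) (if j = 0 then 1 else 2)"
  by (cases "j = 0") (simp_all only: zfree_def mult_2 mult_1_left zcoeff_add if_True if_False simp_thms)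

lemma zcoeff_rhs2_term:
  "zcoeff k (rhs2_term n) =
    (\<Sum>j\<in>{0..n div 2}. if k = int n - 2 * int j + 1
       then (- 1) ^ (n + j) * (if j = 0 then 1 else 2) * fps_X ^ nat ((((int n)\<^sup>2 - 2 * (int j)\<^sup>2) + int n) div 2) else 0) +
    (\<Sum>j\<in>{0..n div 2}. if k = 2 * int j - int n
       then (- 1) ^ (n + j) * (if j = 0 then 1 else 2) * fps_X ^ nat ((((int n)\<^sup>2 - 2 * (int j)\<^sup>2) + int n) div 2) else 0)"
proof -
  define f where "f m = (- 1) ^ (n + nat m) * (zpow (int n - 2 * m + 1) + zpow (2 * m - int n)) *
      qhalf (((int n)\<^sup>2 - 2 * m\<^sup>2) + int n)" for m
  have "rhs2_term n = (\<Sum>m\<in>{- int (n div 2)..int (n div 2)}. f \<bar>m\<bar>)"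
    unfolding rhs2_term_def f_def by simp
  also have "\<dots> = (\<Sum>j\<in>{0..n div 2}. (if j = 0 then 1 else 2) * f (int j))"
    by (rule sum_abs_symmetric)
  finally have "zcoeff k (rhs2_term n) = (\<Sum>j\<in>{0..n div 2}. (if j = 0 then 1 else 2) * zcoeff k (f (int j)))"
    by (simp only: zcoeff_sum zfreeD[OF zfree_weight])
  moreover have "zcoeff k (f (int j)) = (if k = int n - 2 * int j + 1 then (- 1) ^ (n + j) * fps_X ^ nat ((((int n)\<^sup>2 - 2 * (int j)\<^sup>2) + int n) div 2) else 0) +
      (if k = 2 * int j - int n then (- 1) ^ (n + j) * fps_X ^ nat ((((int n)\<^sup>2 - 2 * (int j)\<^sup>2) + int n) div 2) else 0)" for j
    unfolding f_def distrib_left distrib_right zcoeff_add zcoeff_monomial nat_int ..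
  ultimately show ?thesis
    unfolding sum.distrib[symmetric] by (simp only:) (intro sum.cong refl, simp)
qed

lemma zcoeff_rhs3_term:
  "zcoeff k (rhs3_term n) =
    (\<Sum>j\<in>{0..n div 3}. if k = int n + 1 - 4 * int j
       then (- 1) ^ n * (if j = 0 then 1 else 2) * fps_X ^ nat ((((int n)\<^sup>2 - 8 * (int j)\<^sup>2) + int n) div 2) else 0) +
    (\<Sum>j\<in>{0..n div 3}. if k = 4 * int j - int n
       then (- 1) ^ n * (if j = 0 then 1 else 2) * fps_X ^ nat ((((int n)\<^sup>2 - 8 * (int j)\<^sup>2) + int n) div 2) else 0)"
proof -
  define f where "f m = (- 1) ^ n * (zpow (int n + 1 - 4 * m) + zpow (4 * m - int n)) *
      qhalf (((int n)\<^sup>2 - 8 * m\<^sup>2) + int n)" for m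
  have "rhs3_term n = (\<Sum>m\<in>{- int (n div 3)..int (n div 3)}. f \<bar>m\<bar>)"
    unfolding rhs3_term_def f_def by simp
  also have "\<dots> = (\<Sum>j\<in>{0..n div 3}. (if j = 0 then 1 else 2) * f (int j))"
    by (rule sum_abs_symmetric)
  finally have "zcoeff k (rhs3_term n) = (\<Sum>j\<in>{0..n div 3}. (if j = 0 then 1 else 2) * zcoeff k (f (int j)))"
    by (simp only: zcoeff_sum zfreeD[OF zfree_weight])
  moreover have "zcoeff k (f (int j)) = (if k = int n + 1 - 4 * int j then (- 1) ^ n * fps_X ^ nat ((((int n)\<^sup>2 - 8 * (int j)\<^sup>2) + int n) div 2) else 0) +
      (if k = 4 * int j - int n then (- 1) ^ n * fps_X ^ nat ((((int n)\<^sup>2 - 8 * (int j)\<^sup>2) + int n) div 2) else 0)" for j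
    unfolding f_def distrib_left distrib_right zcoeff_add zcoeff_monomial nat_int ..
  ultimately show ?thesis
    unfolding sum.distrib[symmetric] by (simp only:) (intro sum.cong refl, simp)
qed

lemma zcoeff_rhs4_term:
  "zcoeff k (rhs4_term n) =
    (\<Sum>m\<in>{0..n}. if k = int m - int n
       then (- 1) ^ n * fps_X ^ nat (((2 * (int n)\<^sup>2 - (int m)\<^sup>2) + (2 * int n - int m)) div 2) else 0) +
    (\<Sum>m\<in>{1..n}. if k = int n - int m + 1
       then (- 1) ^ n * fps_X ^ nat (((2 * (int n)\<^sup>2 - (int m)\<^sup>2) + (2 * int n + int m)) div 2) else 0)"
  unfolding rhs4_term_def zcoeff_add zcoeff_sum zcoeff_monomial ..

text \<open>The two exponents of \<open>z\<close> in each summand add up to 1, so the reflection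
  exchanges the two sums.\<close>

lemma zcoeff_rhs2_term_reflect: "zcoeff (1 - k) (rhs2_term n) = zcoeff k (rhs2_term n)"
proof -
  have "1 - k = int n - 2 * int j + 1 \<longleftrightarrow> k = 2 * int j - int n"
    "1 - k = 2 * int j - int n \<longleftrightarrow> k = int n - 2 * int j + 1" for j
    by auto
  then show ?thesis unfolding zcoeff_rhs2_term by (simp only: add_ac)
qed

lemma zcoeff_rhs3_term_reflect: "zcoeff (1 - k) (rhs3_term n) = zcoeff k (rhs3_term n)"
proof -
  have "1 - k = int n + 1 - 4 * int j \<longleftrightarrow> k = 4 * int j - int n"
    "1 - k = 4 * int j - int n \<longleftrightarrow> k = int n + 1 - 4 * int j" for j
    by auto
  then show ?thesis unfolding zcoeff_rhs3_term by (simp only: add_ac)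
qed

text \<open>The partial theta series shared by identities (2) and (3): up to sign and a triangular
  power it is the coefficient of z^(k+1) on all sides.\<close>

definition overpartition_term :: "nat \<Rightarrow> nat \<Rightarrow> int fps" where
  "overpartition_term k m = (if m = 0 then 1 else 2) * (- 1) ^ m * fps_X ^ (m\<^sup>2 + (2 * k + 1) * m)"

lemma overpartition_term_sums:
  fixes k :: nat
  defines "\<beta> \<equiv> pbeta fps_X (\<lambda>n. qpoch (- 1) fps_X n * fps_X ^ (n * (n + 1) div 2))"
  shows "overpartition_term k sums (\<beta> k - fps_X ^ Suc k * \<beta> (Suc k))"
proof -
  have "(\<lambda>m. 2 * (- 1) ^ m * fps_X ^ (m\<^sup>2 + (2 * k + 1) * m) - 1 * (if m = 0 then 1 else 0)) sums
      (\<beta> k - fps_X ^ Suc k * \<beta> (Suc k) + 1 - 1 * 1)"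
    unfolding \<beta>_def by (intro fps_sums_diff_mult pbeta_overpartition_sums) (rule sums_single)
  moreover have "(\<lambda>m. 2 * (- 1) ^ m * fps_X ^ (m\<^sup>2 + (2 * k + 1) * m) - 1 * (if m = 0 then 1 else 0)) =
      overpartition_term k"
    by (auto simp: overpartition_term_def)
  ultimately show ?thesis by simp
qed

text \<open>Only the powers \<open>int n - 2 * int j + 1\<close> can be positive, so a single line
  of index pairs contributes.\<close>

lemma zcoeff_rhs2:
  "zcoeff (int k + 1) (suminf rhs2_term) =
    (- 1) ^ k * fps_X ^ (k * (k + 1) div 2) * suminf (overpartition_term k)"
proof -
  define F where "F n j = (- 1) ^ (n + j) * (if j = 0 then 1 else 2) *
      (fps_X :: int fps) ^ nat ((((int n)\<^sup>2 - 2 * (int j)\<^sup>2) + int n) div 2)" for n j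
  define S where "S = (- 1 :: int fps) ^ k * fps_X ^ (k * (k + 1) div 2)"
  have F: "F (2 * i + k) i = S * overpartition_term k i" for i
  proof -
    have 1: "nat ((((int (2 * i + k))\<^sup>2 - 2 * (int i)\<^sup>2) + int (2 * i + k)) div 2) =
        k * (k + 1) div 2 + (i\<^sup>2 + (2 * k + 1) * i)"
      using tri_int[of k] by (intro nat_half) (simp add: power2_eq_square algebra_simps)
    have 2: "(- 1 :: int fps) ^ (2 * i + k + i) = (- 1) ^ (k + i)"
      by (rule minus_one_power_cong) simp
    show ?thesis
      unfolding F_def S_def overpartition_term_def 1 2 power_add[of fps_X "k * (k + 1) div 2"] power_add[of "- 1" k]
      by (simp only: mult_ac)
  qed
  have "overpartition_term k sums suminf (overpartition_term k)"
    using overpartition_term_sums[of k] by (auto simp: sums_iff)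
  then have "(\<lambda>i. F (2 * i + k) i) sums (S * suminf (overpartition_term k))"
    unfolding F by (rule fps_sums_mult)
  then have "(\<lambda>n. \<Sum>j\<in>{0..n div 2}. if int k + 1 = int n - 2 * int j + 1 then F n j else 0) sums
      (S * suminf (overpartition_term k))"
  proof (rule sums_indicator_reindex)
    show "j \<in> {0..n div 2} \<and> int k + 1 = int n - 2 * int j + 1 \<longleftrightarrow> (\<exists>i. n = 2 * i + k \<and> j = i)" for n j
      by auto
  qed (auto simp: strict_mono_def)
  moreover have "(\<Sum>j\<in>{0..n div 2}. if int k + 1 = 2 * int j - int n then F n j else 0) = 0" for n
    by (intro sum.neutral) auto
  ultimately have "(\<lambda>n. zcoeff (int k + 1) (rhs2_term n)) sums (S * suminf (overpartition_term k))"
    unfolding zcoeff_rhs2_term F_def by simp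
  moreover have "(\<lambda>n. zcoeff (int k + 1) (rhs2_term n)) sums zcoeff (int k + 1) (suminf rhs2_term)"
    by (intro zcoeff_sums summable_sums summable_terms)
  ultimately show ?thesis
    unfolding S_def using sums_unique2 by blast
qed

text \<open>Both families of powers contribute: the first gives the terms of even index of
  \<open>overpartition_term k\<close>, the second those of odd index.\<close>

lemma zcoeff_rhs3:
  "zcoeff (int k + 1) (suminf rhs3_term) =
    (- 1) ^ k * fps_X ^ (k * (k + 1) div 2) * suminf (overpartition_term k)"
proof -
  define F where "F n j = (- 1) ^ n * (if j = 0 then 1 else 2) *
      (fps_X :: int fps) ^ nat ((((int n)\<^sup>2 - 8 * (int j)\<^sup>2) + int n) div 2)" for n j :: nat
  define S where "S = (- 1 :: int fps) ^ k * fps_X ^ (k * (k + 1) div 2)"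
  note t = tri_int[of k]
  have F1: "F (4 * i + k) i = S * overpartition_term k (2 * i)" for i
  proof -
    have 1: "nat ((((int (4 * i + k))\<^sup>2 - 8 * (int i)\<^sup>2) + int (4 * i + k)) div 2) =
        k * (k + 1) div 2 + ((2 * i)\<^sup>2 + (2 * k + 1) * (2 * i))"
      using t by (intro nat_half) (simp add: power2_eq_square algebra_simps)
    have 2: "(- 1 :: int fps) ^ (4 * i + k) = (- 1) ^ (k + 2 * i)"
      by (rule minus_one_power_cong) simp
    have 3: "2 * i = 0 \<longleftrightarrow> i = 0" by simp
    show ?thesis
      unfolding F_def S_def overpartition_term_def 1 2 3 power_add[of fps_X "k * (k + 1) div 2"] power_add[of "- 1" k]
      by (simp only: mult_ac)
  qed
  have F2: "F (4 * i + 3 * k + 3) (k + 1 + i) = S * overpartition_term k (2 * i + 1)" for i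
  proof -
    have 1: "nat ((((int (4 * i + 3 * k + 3))\<^sup>2 - 8 * (int (k + 1 + i))\<^sup>2) + int (4 * i + 3 * k + 3)) div 2) =
        k * (k + 1) div 2 + ((2 * i + 1)\<^sup>2 + (2 * k + 1) * (2 * i + 1))"
      using t by (intro nat_half) (simp add: power2_eq_square algebra_simps)
    have 2: "(- 1 :: int fps) ^ (4 * i + 3 * k + 3) = (- 1) ^ (k + (2 * i + 1))"
      by (rule minus_one_power_cong) simp
    have 3: "k + 1 + i = 0 \<longleftrightarrow> 2 * i + 1 = 0" by simp
    show ?thesis
      unfolding F_def S_def overpartition_term_def 1 2 3 power_add[of fps_X "k * (k + 1) div 2"] power_add[of "- 1" k]
      by (simp only: mult_ac)
  qed
  have "summable (\<lambda>i. overpartition_term k (2 * i))" "summable (\<lambda>i. overpartition_term k (2 * i + 1))"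
    unfolding overpartition_term_def by (intro fps_dvd_summable dvd_mult dvd_power_of_dvd; simp)+
  then obtain a b where a: "(\<lambda>i. overpartition_term k (2 * i)) sums a"
    and b: "(\<lambda>i. overpartition_term k (2 * i + 1)) sums b"
    by (auto simp: summable_def)
  have "(\<lambda>n. \<Sum>j\<in>{0..n div 3}. if int k + 1 = int n + 1 - 4 * int j then F n j else 0) sums (S * a)"
  proof (rule sums_indicator_reindex)
    show "(\<lambda>i. F (4 * i + k) i) sums (S * a)"
      unfolding F1 by (intro fps_sums_mult a)
    show "j \<in> {0..n div 3} \<and> int k + 1 = int n + 1 - 4 * int j \<longleftrightarrow> (\<exists>i. n = 4 * i + k \<and> j = i)" for n j
      by auto
  qed (auto simp: strict_mono_def)
  moreover have "(\<lambda>n. \<Sum>j\<in>{0..n div 3}. if int k + 1 = 4 * int j - int n then F n j else 0) sums (S * b)"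
  proof (rule sums_indicator_reindex)
    show "(\<lambda>i. F (4 * i + 3 * k + 3) (k + 1 + i)) sums (S * b)"
      unfolding F2 by (intro fps_sums_mult b)
    show "j \<in> {0..n div 3} \<and> int k + 1 = 4 * int j - int n \<longleftrightarrow> (\<exists>i. n = 4 * i + 3 * k + 3 \<and> j = k + 1 + i)" for n j
      by (auto intro!: exI[of _ "j - k - 1"])
  qed (auto simp: strict_mono_def)
  ultimately have "(\<lambda>n. zcoeff (int k + 1) (rhs3_term n)) sums (S * a + S * b)"
    unfolding zcoeff_rhs3_term F_def by (intro sums_add)
  moreover have "(\<lambda>n. zcoeff (int k + 1) (rhs3_term n)) sums zcoeff (int k + 1) (suminf rhs3_term)"
    by (intro zcoeff_sums summable_sums summable_terms)
  ultimately have "zcoeff (int k + 1) (suminf rhs3_term) = S * (a + b)"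
    using sums_unique2 by (fastforce simp: distrib_left)
  moreover have "suminf (overpartition_term k) = a + b"
    using fps_sums_even_odd[OF a b] by (rule sums_unique[symmetric])
  ultimately show ?thesis unfolding S_def by simp
qed

text \<open>The first double sum carries exactly the powers of \<open>z\<close> with
  \<open>k \<le> 0\<close>, the second those with \<open>k \<ge> 1\<close>. Shifting
  \<open>m\<close> by one in the second makes the exponents of \<open>q\<close> agree.\<close>

lemma zcoeff_rhs4:
  "zcoeff k (suminf rhs4_term) = (- 1) ^ nat \<bar>k\<bar> * (fps_X\<^sup>2) ^ (nat \<bar>k\<bar> * (nat \<bar>k\<bar> + 1) div 2) *
    pbeta (fps_X\<^sup>2) (\<lambda>n. (- 1) ^ n * fps_X ^ n\<^sup>2 * qpoch fps_X (fps_X\<^sup>2) n) (nat \<bar>k\<bar>)"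
proof -
  define j where "j = nat \<bar>k\<bar>"
  define \<beta> where "\<beta> = pbeta (fps_X\<^sup>2) (\<lambda>n. (- 1) ^ n * fps_X ^ n\<^sup>2 * qpoch fps_X (fps_X\<^sup>2) n) j"
  define S where "S = (- 1 :: int fps) ^ j * (fps_X\<^sup>2) ^ (j * (j + 1) div 2)"
  define h :: "nat \<Rightarrow> int fps" where "h = (\<lambda>m. (- 1) ^ m * fps_X ^ (m * (m + 1) div 2 + 2 * m * j))"
  have h: "(\<lambda>i. S * h i) sums (S * \<beta>)"
    unfolding h_def \<beta>_def by (intro fps_sums_mult pbeta_M2_sums)
  define F where "F n m = (- 1 :: int fps) ^ n * fps_X ^ nat (((2 * (int n)\<^sup>2 - (int m)\<^sup>2) + (2 * int n - int m)) div 2)" for n m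
  define G where "G n m = (- 1 :: int fps) ^ n * fps_X ^ nat (((2 * (int n)\<^sup>2 - (int m)\<^sup>2) + (2 * int n + int m)) div 2)" for n m
  have S: "S = (- 1) ^ j * fps_X ^ (2 * (j * (j + 1) div 2))"
    unfolding S_def by (simp only: power_mult)
  have F: "F (i + j) i = S * h i" and G: "G (i + j) (i + 1) = S * h i" for i
  proof -
    note t = tri_int[of j] tri_int[of i]
    have 1: "nat (((2 * (int (i + j))\<^sup>2 - (int i)\<^sup>2) + (2 * int (i + j) - int i)) div 2) =
        2 * (j * (j + 1) div 2) + (i * (i + 1) div 2 + 2 * i * j)"
      using t by (intro nat_half) (simp add: power2_eq_square algebra_simps)
    have 2: "nat (((2 * (int (i + j))\<^sup>2 - (int (i + 1))\<^sup>2) + (2 * int (i + j) + int (i + 1))) div 2) =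
        2 * (j * (j + 1) div 2) + (i * (i + 1) div 2 + 2 * i * j)"
      using t by (intro nat_half) (simp add: power2_eq_square algebra_simps)
    show "F (i + j) i = S * h i" "G (i + j) (i + 1) = S * h i"
      unfolding F_def G_def S h_def 1 2 power_add[of fps_X "2 * (j * (j + 1) div 2)"] power_add[of "- 1"]
      by (simp_all only: mult_ac)
  qed
  have "(\<lambda>n. zcoeff k (rhs4_term n)) sums (S * \<beta>)"
  proof (cases "k \<le> 0")
    case True
    then have k: "k = - int j" by (simp add: j_def)
    have "(\<lambda>n. \<Sum>m\<in>{0..n}. if k = int m - int n then F n m else 0) sums (S * \<beta>)"
    proof (rule sums_indicator_reindex)
      show "(\<lambda>i. F (i + j) i) sums (S * \<beta>)" unfolding F by (rule h)
      show "m \<in> {0..n} \<and> k = int m - int n \<longleftrightarrow> (\<exists>i. n = i + j \<and> m = i)" for n m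
        unfolding k by auto
    qed (auto simp: strict_mono_def)
    moreover have "(\<Sum>m\<in>{1..n}. if k = int n - int m + 1 then G n m else 0) = 0" for n
      unfolding k by (intro sum.neutral) auto
    ultimately show ?thesis unfolding zcoeff_rhs4_term F_def G_def by simp
  next
    case False
    then have k: "k = int j" "j \<ge> 1" by (simp_all add: j_def)
    have "(\<lambda>n. \<Sum>m\<in>{1..n}. if k = int n - int m + 1 then G n m else 0) sums (S * \<beta>)"
    proof (rule sums_indicator_reindex)
      show "(\<lambda>i. G (i + j) (i + 1)) sums (S * \<beta>)" unfolding G by (rule h)
      show "m \<in> {1..n} \<and> k = int n - int m + 1 \<longleftrightarrow> (\<exists>i. n = i + j \<and> m = i + 1)" for n m
        using k by (auto intro!: exI[of _ "m - 1"])
    qed (auto simp: strict_mono_def)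
    moreover have "(\<Sum>m\<in>{0..n}. if k = int m - int n then F n m else 0) = 0" for n
      using k by (intro sum.neutral) auto
    ultimately show ?thesis unfolding zcoeff_rhs4_term F_def G_def by simp
  qed
  moreover have "(\<lambda>n. zcoeff k (rhs4_term n)) sums zcoeff k (suminf rhs4_term)"
    by (intro zcoeff_sums summable_sums summable_terms)
  ultimately show ?thesis
    unfolding S_def \<beta>_def j_def using sums_unique2 by blast
qed

section \<open>Coefficients of the left-hand sides and comparison\<close>

lemma zcoeff_R_series:
  "zcoeff k (triple_prod q * R_series) = (- 1) ^ nat \<bar>k\<bar> * fps_X ^ (nat \<bar>k\<bar> * (nat \<bar>k\<bar> + 1) div 2) *
    pbeta fps_X (\<lambda>n. fps_X ^ n\<^sup>2) (nat \<bar>k\<bar>)"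
  unfolding R_series_def
proof (rule zcoeff_triple_prod_series)
  show "fps_X ^ n dvd (fps_X :: int fps) ^ n\<^sup>2" for n
    by (intro dvd_power_of_dvd) (auto simp: power2_eq_square)
qed (auto simp: R_term_def qdenom_def summable_terms)

lemma zcoeff_H_series:
  "zcoeff k (triple_prod q * H_series) = (- 1) ^ nat \<bar>k\<bar> * fps_X ^ (nat \<bar>k\<bar> * (nat \<bar>k\<bar> + 1) div 2) *
    pbeta fps_X (\<lambda>n. qpoch (- 1) fps_X n * fps_X ^ (n * (n + 1) div 2)) (nat \<bar>k\<bar>)"
  unfolding H_series_def
proof (rule zcoeff_triple_prod_series)
  show "fps_X ^ n dvd qpoch (- 1) fps_X n * (fps_X :: int fps) ^ (n * (n + 1) div 2)" for n
    by (intro dvd_mult dvd_power_of_dvd le_tri) auto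
qed (auto simp: H_term_def qdenom_def summable_terms)

lemma zcoeff_K_series:
  "zcoeff k (triple_prod (q\<^sup>2) * K_series) = (- 1) ^ nat \<bar>k\<bar> * (fps_X\<^sup>2) ^ (nat \<bar>k\<bar> * (nat \<bar>k\<bar> + 1) div 2) *
    pbeta (fps_X\<^sup>2) (\<lambda>n. (- 1) ^ n * fps_X ^ n\<^sup>2 * qpoch fps_X (fps_X\<^sup>2) n) (nat \<bar>k\<bar>)"
  unfolding K_series_def
proof (rule zcoeff_triple_prod_series)
  show "fps_X ^ n dvd (- 1) ^ n * (fps_X :: int fps) ^ n\<^sup>2 * qpoch fps_X (fps_X\<^sup>2) n" for n
    by (intro dvd_mult2 dvd_mult dvd_power_of_dvd) (auto simp: power2_eq_square)
  show "zfree ((- 1) ^ n * q ^ n\<^sup>2 * qpoch q (q\<^sup>2) n) ((- 1) ^ n * fps_X ^ n\<^sup>2 * qpoch fps_X (fps_X\<^sup>2) n)" for n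
    by (intro zfree_mult zfree_power zfree_uminus zfree_1 zfree_X zfree_qpoch)
qed (auto simp: K_term_def qdenom_def summable_terms)

text \<open>The factor 1 + z adds the coefficients at \<open>k + 1\<close> and \<open>k\<close>.
  Their signs are opposite and their triangular exponents differ by \<open>k + 1\<close>, which
  produces the combination in \<open>overpartition_term_sums\<close>.\<close>

lemma zcoeff_H_series_times:
  "zcoeff (int k + 1) ((1 + zpow 1) * (triple_prod q * H_series)) =
    (- 1) ^ k * fps_X ^ (k * (k + 1) div 2) * suminf (overpartition_term k)"
proof -
  have k: "int k + 1 = int (Suc k)" by simp
  have "suminf (overpartition_term k) =
      pbeta fps_X (\<lambda>n. qpoch (- 1) fps_X n * fps_X ^ (n * (n + 1) div 2)) k -
      fps_X ^ Suc k * pbeta fps_X (\<lambda>n. qpoch (- 1) fps_X n * fps_X ^ (n * (n + 1) div 2)) (Suc k)"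
    using overpartition_term_sums[of k] by (simp only: sums_iff)
  then show ?thesis
    unfolding distrib_right zcoeff_add zcoeff_zpow mult_1_left add_diff_cancel_right' zcoeff_H_series
    unfolding k abs_of_nat nat_int tri_Suc power_add[of _ "k * (k + 1) div 2"]
    by (simp only:) (simp add: algebra_simps del: power_Suc, simp add: mult_ac)
qed

lemma zcoeff_H_series_times_reflect:
  "zcoeff (1 - k) ((1 + zpow 1) * (triple_prod q * H_series)) =
    zcoeff k ((1 + zpow 1) * (triple_prod q * H_series))"
proof -
  have "\<bar>1 - k\<bar> = \<bar>k - 1\<bar>" "\<bar>1 - k - 1\<bar> = \<bar>k\<bar>" by auto
  then show ?thesis
    unfolding distrib_right zcoeff_add zcoeff_zpow mult_1_left zcoeff_H_series by (simp only: add.commute)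
qed

text \<open>The reflection of \<open>k\<close> to \<open>1 - k\<close> exchanges the positive
  indices with the others, so comparing positive ones suffices.\<close>

lemma zcoeff_eqI_reflect:
  assumes "\<And>k. zcoeff (int k + 1) f = zcoeff (int k + 1) g"
    and "\<And>k. zcoeff (1 - k) f = zcoeff k f" "\<And>k. zcoeff (1 - k) g = zcoeff k g"
  shows "f = g"
proof (rule zcoeff_eqI)
  fix k
  have pos: "zcoeff k f = zcoeff k g" if "k \<ge> 1" for k
    using assms(1)[of "nat (k - 1)"] that by simp
  show "zcoeff k f = zcoeff k g"
    using pos[of k] pos[of "1 - k"] assms(2,3)[of k] by (cases "k \<ge> 1") auto
qed

theorem theorem1p1:
  shows
    "2 * (qpoch_inf (zpow 1 * q) q * qpoch_inf (zpow (-1) * q) q * qpoch_inf q q * R_series)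
         = suminf rhs1_term
     \<and> (1 + zpow 1) * qpoch_inf (zpow 1 * q) q * qpoch_inf (zpow (-1) * q) q * qpoch_inf q q
           * H_series
         = suminf rhs2_term
     \<and> (1 + zpow 1) * qpoch_inf (zpow 1 * q) q * qpoch_inf (zpow (-1) * q) q * qpoch_inf q q
           * H_series
         = suminf rhs3_term
     \<and> qpoch_inf (zpow 1 * q\<^sup>2) (q\<^sup>2) * qpoch_inf (zpow (-1) * q\<^sup>2) (q\<^sup>2)
           * qpoch_inf (q\<^sup>2) (q\<^sup>2) * K_series
         = suminf rhs4_term"
proof -
  note sums = zcoeff_sums[OF summable_sums[OF summable_terms(4)]]
    zcoeff_sums[OF summable_sums[OF summable_terms(5)]] zcoeff_sums[OF summable_sums[OF summable_terms(6)]]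
  have "2 * (triple_prod q * R_series) = suminf rhs1_term"
  proof (rule zcoeff_eqI)
    fix k
    \<comment> \<open>Both sides are invariant under exchanging z with 1/z, so the coefficients for
      nonnegative powers, given by \<open>zcoeff_rhs1\<close>, suffice.\<close>
    have "zcoeff (- k) (suminf rhs1_term) = zcoeff k (suminf rhs1_term)" for k
      using sums(1)[of k] sums(1)[of "- k"] unfolding zcoeff_rhs1_term_uminus by (rule sums_unique2[symmetric])
    then have "zcoeff k (suminf rhs1_term) = zcoeff (int (nat \<bar>k\<bar>)) (suminf rhs1_term)"
      by (cases "k \<ge> 0") (simp_all add: abs_if)
    then show "zcoeff k (2 * (triple_prod q * R_series)) = zcoeff k (suminf rhs1_term)"
      unfolding zcoeff_rhs1 mult_2 zcoeff_add zcoeff_R_series by simp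
  qed
  moreover have "(1 + zpow 1) * (triple_prod q * H_series) = suminf rhs2_term"
  proof (rule zcoeff_eqI_reflect)
    show "zcoeff (1 - k) (suminf rhs2_term) = zcoeff k (suminf rhs2_term)" for k
      using sums(2)[of k] sums(2)[of "1 - k"] unfolding zcoeff_rhs2_term_reflect by (rule sums_unique2[symmetric])
  qed (simp_all only: zcoeff_H_series_times zcoeff_rhs2 zcoeff_H_series_times_reflect)
  moreover have "(1 + zpow 1) * (triple_prod q * H_series) = suminf rhs3_term"
  proof (rule zcoeff_eqI_reflect)
    show "zcoeff (1 - k) (suminf rhs3_term) = zcoeff k (suminf rhs3_term)" for k
      using sums(3)[of k] sums(3)[of "1 - k"] unfolding zcoeff_rhs3_term_reflect by (rule sums_unique2[symmetric])
  qed (simp_all only: zcoeff_H_series_times zcoeff_rhs3 zcoeff_H_series_times_reflect)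
  moreover have "triple_prod (q\<^sup>2) * K_series = suminf rhs4_term"
    by (rule zcoeff_eqI) (simp only: zcoeff_K_series zcoeff_rhs4)
  ultimately show ?thesis
    unfolding triple_prod_def by (simp only: mult.assoc)
qed

end
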